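(* For any $n$-by-$n$ complex matrix $A$, $d(A)=\min\{d(\mathrm{Re}(e^{-i\theta}A)):\theta\in\mathbb{R}\}$.
   Context: For an $n$-by-$n$ complex matrix $A$, the zero-dilation index $d(A)$ is the largest integer $k\ge 1$ such that there is an $n$-by-$k$ complex matrix $V$ with $V^*V=I_k$ and $V^*AV=0_k$, where $0_k$ is the $k$-by-$k$ zero matrix; if no such $k$ exists, $d(A)=0$. $\mathrm{Re}\,B=(B+B^* )/2$ for a square matrix $B$. *)

theory Defs
  imports Complex_Main "Jordan_Normal_Form.Schur_Decomposition"
begin

definition Re_mat :: "complex mat \<Rightarrow> complex mat" where
  "Re_mat B = (1 / 2) \<cdot>\<^sub>m (B + mat_adjoint B)"

definition has_zero_dilation :: "complex mat \<Rightarrow> nat \<Rightarrow> bool" where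
  "has_zero_dilation A k \<longleftrightarrow>
     (\<exists>V \<in> carrier_mat (dim_row A) k.
        mat_adjoint V * V = 1\<^sub>m k \<and> mat_adjoint V * A * V = 0\<^sub>m k k)"

(* The condition on V forces its k columns to be orthonormal, hence k \<le> dim_row A; so the
   greatest k below is well defined whenever one exists. *)
definition zero_dilation_index :: "complex mat \<Rightarrow> nat" where
  "zero_dilation_index A =
     (if \<exists>k\<ge>1. has_zero_dilation A k
      then GREATEST k. k \<ge> 1 \<and> has_zero_dilation A k
      else 0)"

end

theory Submission
  imports Defs "HOL-Library.Function_Algebras"
begin

text \<open>The nontrivial inequality is a dimension count for sesquilinear forms: if for almost every
  direction \<open>z\<close> the hermitian form \<open>Re (cnj z * f y y)\<close> is nonnegative on some \<open>k\<close>-dimensional subspace,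
  then \<open>f\<close> vanishes on a \<open>k\<close>-dimensional subspace. Induct on the dimension. If the pencil spanned by \<open>f\<close>
  and its adjoint is singular at a vector \<open>x\<close> with \<open>f x x = 0\<close>, then the orthogonal space of \<open>x\<close> has
  codimension at most one, and passing to it modulo \<open>x\<close> lowers \<open>k\<close> by one (outside one real line of
  directions, which is why only almost every \<open>z\<close> is considered). Otherwise \<open>f\<close> has an orthogonal basis,
  and the values \<open>c x = f x x\<close> are nonzero points of the plane, no two of them in opposite
  directions, with at least \<open>k\<close> of them in almost every half-plane. Rotating a half-plane that contains
  the fewest points, and keeping those points at which the count passes between its minimum and the
  next value, selects \<open>2 r + 1\<close> points of alternating type; Lagrange weights at these points yield an
  explicit isotropic subspace of dimension \<open>r\<close>, while the remaining points still have at least \<open>k - r\<close>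
  members in almost every half-plane.\<close>

section \<open>Sign changes along a rotating half-plane\<close>

text \<open>The sum is the coefficient of degree \<open>card J - 1\<close> in the Lagrange
  interpolant of \<open>t ^ m\<close> at the nodes \<open>s j\<close>. As
  \<open>m < card J - 1\<close>, the interpolant is \<open>t ^ m\<close> itself and that coefficient
  vanishes.\<close>

lemma lagrange_moments:
  fixes s :: "'a \<Rightarrow> real"
  assumes fin: "finite J" and inj: "inj_on s J" and m: "m + 2 \<le> card J"
  shows "(\<Sum>j\<in>J. s j ^ m / (\<Prod>i\<in>J - {j}. s j - s i)) = 0"
proof -
  define L where "L j = (\<Prod>i\<in>J - {j}. [:- s i, 1:])" for j
  define w where "w j = s j ^ m / (\<Prod>i\<in>J - {j}. s j - s i)" for j
  define p where "p = (\<Sum>j\<in>J. smult (w j) (L j)) - monom 1 m"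
  have degL: "degree (L j) = card J - 1" if "j \<in> J" for j
    unfolding L_def using that fin by (subst degree_prod_eq_sum_degree) auto
  have leadL: "coeff (L j) (card J - 1) = 1" if "j \<in> J" for j
  proof -
    have "lead_coeff (L j) = 1" unfolding L_def by (simp add: lead_coeff_prod)
    then show ?thesis using degL[OF that] by simp
  qed
  have degp: "degree p \<le> card J - 1"
    unfolding p_def using m fin degL
    by (intro degree_diff_le degree_sum_le)
       (auto intro: order_trans[OF degree_smult_le] order_trans[OF degree_monom_le])
  have Lval: "poly (L j) (s i) = (if i = j then (\<Prod>l\<in>J - {j}. s j - s l) else 0)"
    if "i \<in> J" "j \<in> J" for i j
    using that fin unfolding L_def poly_prod by (auto intro!: prod_zero)
  have root: "poly p (s i) = 0" if i: "i \<in> J" for i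
  proof -
    have ne: "(\<Prod>l\<in>J - {i}. s i - s l) \<noteq> 0"
      using fin inj i by (auto simp: inj_on_def)
    have "(\<Sum>j\<in>J. w j * poly (L j) (s i)) = (\<Sum>j\<in>J. if j = i then s i ^ m else 0)"
      using ne i by (intro sum.cong) (auto simp: Lval w_def)
    then show ?thesis using fin i by (simp add: p_def poly_sum poly_monom)
  qed
  have "p = 0"
  proof (rule ccontr)
    assume "p \<noteq> 0"
    then have "card (s ` J) \<le> degree p"
      by (intro order_trans[OF card_mono card_poly_roots_bound] poly_roots_finite)
        (auto simp: root)
    then show False using degp m card_image[OF inj] by simp
  qed
  then have "coeff (\<Sum>j\<in>J. smult (w j) (L j)) (card J - 1) = coeff (monom 1 m) (card J - 1)"
    by (simp add: p_def)
  then show ?thesis using m leadL by (simp add: coeff_sum w_def)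
qed

lemma sgn_prod_eq:
  fixes f :: "'a \<Rightarrow> real"
  assumes "finite A" "\<And>i. i \<in> A \<Longrightarrow> f i \<noteq> 0"
  shows "sgn (\<Prod>i\<in>A. f i) = (-1) ^ card {i\<in>A. f i < 0}"
  using assms
proof (induction A rule: finite_induct)
  case (insert x F)
  have "{i \<in> insert x F. f i < 0} = (if f x < 0 then insert x {i\<in>F. f i < 0} else {i\<in>F. f i < 0})"
    by auto
  moreover have "sgn (f x) = (if f x < 0 then -1 else 1)" using insert.prems[of x] by auto
  moreover have "sgn (\<Prod>i\<in>F. f i) = (-1) ^ card {i\<in>F. f i < 0}" using insert by simp
  ultimately show ?case using insert.hyps by (simp add: sgn_mult)
qed auto

text \<open>A rotating line meets the points in the order of their indices, and \<open>e j\<close> says whether point \<open>j\<close>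
  starts on its positive side. After the line has passed the points below \<open>m\<close>, \<open>flip_count N e m\<close>
  points lie on that side.\<close>
definition flip_count :: "nat \<Rightarrow> (nat \<Rightarrow> bool) \<Rightarrow> nat \<Rightarrow> nat" where
  "flip_count N e m = card {j. j < N \<and> (if j < m then \<not> e j else e j)}"

text \<open>\<open>s\<close> lists the slopes at which the line meets the points; \<open>k\<close>
  is the least count, attained at the start. The first step must go up to \<open>Suc k\<close>, and
  by \<open>upper\<close> the walk then ends strictly above its minimum.\<close>

locale sign_walk =
  fixes N k :: nat and e :: "nat \<Rightarrow> bool" and s :: "nat \<Rightarrow> real"
  assumes pos: "N > 0"
    and mono: "\<And>i j. i \<le> j \<Longrightarrow> j < N \<Longrightarrow> s i \<le> s j"
    and ties: "\<And>i j. i < N \<Longrightarrow> j < N \<Longrightarrow> s i = s j \<Longrightarrow> e i = e j"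
    and start: "flip_count N e 0 = k"
    and lower: "\<And>m. m \<le> N \<Longrightarrow> k \<le> flip_count N e m"
    and upper: "flip_count N e (Suc 0) \<le> flip_count N e N"
begin

abbreviation u :: "nat \<Rightarrow> nat" where "u \<equiv> flip_count N e"

text \<open>The crossings between the levels \<open>k\<close> and \<open>Suc k\<close>. Up and down
  crossings alternate, and as the walk starts at \<open>k\<close> and ends above it, the first and
  the last go up.\<close>

definition J :: "nat set" where
  "J = {j. j < N \<and> (u j = k \<and> u (Suc j) = Suc k \<or> u j = Suc k \<and> u (Suc j) = k)}"

lemma finite_J: "finite J" unfolding J_def by simp

lemma J_less: "j \<in> J \<Longrightarrow> j < N" unfolding J_def by simp

lemma u_Suc:
  assumes "m < N"
  shows "if e m then u m = Suc (u (Suc m)) else u (Suc m) = Suc (u m)"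
proof -
  define R where "R = {j. j < N \<and> j \<noteq> m \<and> (if j < m then \<not> e j else e j)}"
  have fR: "finite R" "m \<notin> R" unfolding R_def by auto
  have "{j. j < N \<and> (if j < m then \<not> e j else e j)} = (if e m then insert m R else R)"
    using assms unfolding R_def by auto
  moreover have "{j. j < N \<and> (if j < Suc m then \<not> e j else e j)} = (if e m then R else insert m R)"
    using assms unfolding R_def by (auto simp: less_Suc_eq)
  ultimately show ?thesis unfolding flip_count_def using fR by simp
qed

lemma stop: "u N > k"
  using u_Suc[OF pos] start lower[of "Suc 0"] upper pos by (auto split: if_splits)

lemma up_iff: "j \<in> J \<Longrightarrow> (\<not> e j) \<longleftrightarrow> u j = k"
  using u_Suc[of j] unfolding J_def by (auto split: if_splits)

text \<open>The walk moves by unit steps and never drops below \<open>k\<close>, so it leaves or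
  reaches the level \<open>k\<close> only through a crossing.\<close>

lemma crossings:
  assumes "m \<le> N"
  shows "card {j\<in>J. j < m \<and> \<not> e j} = card {j\<in>J. j < m \<and> e j} + (if u m > k then 1 else 0)"
  using assms
proof (induction m)
  case 0 then show ?case using start by simp
next
  case (Suc m)
  have ih: "card {j\<in>J. j < m \<and> \<not> e j} = card {j\<in>J. j < m \<and> e j} + (if u m > k then 1 else 0)"
    using Suc by simp
  have us: "if e m then u m = Suc (u (Suc m)) else u (Suc m) = Suc (u m)"
    using Suc.prems by (intro u_Suc) simp
  have lo: "k \<le> u m" "k \<le> u (Suc m)" using lower Suc.prems by auto
  have mJ: "m \<in> J \<longleftrightarrow> (u m = k \<and> u (Suc m) = Suc k \<or> u m = Suc k \<and> u (Suc m) = k)"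
    using Suc.prems unfolding J_def by auto
  have A: "{j\<in>J. j < Suc m \<and> \<not> e j} =
      (if m \<in> J \<and> \<not> e m then insert m {j\<in>J. j < m \<and> \<not> e j} else {j\<in>J. j < m \<and> \<not> e j})"
    by (auto simp: less_Suc_eq)
  have B: "{j\<in>J. j < Suc m \<and> e j} =
      (if m \<in> J \<and> e m then insert m {j\<in>J. j < m \<and> e j} else {j\<in>J. j < m \<and> e j})"
    by (auto simp: less_Suc_eq)
  have insA: "card (insert m {j\<in>J. j < m \<and> \<not> e j}) = Suc (card {j\<in>J. j < m \<and> \<not> e j})"
    and insB: "card (insert m {j\<in>J. j < m \<and> e j}) = Suc (card {j\<in>J. j < m \<and> e j})"
    using finite_J by (intro card_insert_disjoint; simp)+
  show ?case
  proof (cases "e m")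
    case True
    then have "u m = Suc (u (Suc m))" using us by simp
    then have "m \<in> J \<longleftrightarrow> u (Suc m) = k" "u m > k" "u (Suc m) = k \<or> u (Suc m) > k"
      using mJ lo by linarith+
    then show ?thesis unfolding A B using ih insB True by (cases "m \<in> J") simp_all
  next
    case False
    then have "u (Suc m) = Suc (u m)" using us by simp
    then have "m \<in> J \<longleftrightarrow> u m = k" "u (Suc m) > k" "u m = k \<or> u m > k"
      using mJ lo by linarith+
    then show ?thesis unfolding A B using ih insA False by (cases "m \<in> J") simp_all
  qed
qed

lemma card_J: "card J = 2 * card {j\<in>J. e j} + 1"
proof -
  have "J = {j\<in>J. e j} \<union> {j\<in>J. \<not> e j}" by auto
  then have "card J = card {j\<in>J. e j} + card {j\<in>J. \<not> e j}"
    using finite_J by (subst card_Un_disjoint[symmetric]) auto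
  moreover have "{j\<in>J. j < N \<and> \<not> e j} = {j\<in>J. \<not> e j}" "{j\<in>J. j < N \<and> e j} = {j\<in>J. e j}"
    using J_less by auto
  ultimately show ?thesis using crossings[of N] stop by simp
qed

text \<open>Removing \<open>J\<close> must not cost a half-plane more than its count can spare: at
  the minimum only half of the even number \<open>card J - 1\<close> is lost, and the extra point is
  lost only where the count is above the minimum.\<close>

lemma count_J:
  assumes "m \<le> N"
  shows "card {j\<in>J. if j < m then \<not> e j else e j} = card {j\<in>J. e j} + (if u m > k then 1 else 0)"
proof -
  have "{j\<in>J. if j < m then \<not> e j else e j} = {j\<in>J. j < m \<and> \<not> e j} \<union> {j\<in>J. \<not> j < m \<and> e j}" by auto
  then have 1: "card {j\<in>J. if j < m then \<not> e j else e j}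
      = card {j\<in>J. j < m \<and> \<not> e j} + card {j\<in>J. \<not> j < m \<and> e j}"
    using finite_J by (simp, subst card_Un_disjoint) auto
  have "{j\<in>J. e j} = {j\<in>J. j < m \<and> e j} \<union> {j\<in>J. \<not> j < m \<and> e j}" by auto
  then have "card {j\<in>J. e j} = card {j\<in>J. j < m \<and> e j} + card {j\<in>J. \<not> j < m \<and> e j}"
    using finite_J by (subst card_Un_disjoint[symmetric]) auto
  then show ?thesis using 1 crossings[OF assms] by simp
qed

text \<open>Two selected indices of equal slope bound a block on which \<open>e\<close> is constant
  by \<open>ties\<close>, so the walk is strictly monotone there. Both are crossings in the same
  direction and hence start at the same level, a contradiction. Distinct slopes can serve as
  interpolation nodes.\<close>

lemma s_neq:
  assumes "i \<in> J" "j \<in> J" "i < j" shows "s i \<noteq> s j"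
proof
  assume eq: "s i = s j"
  have jN: "j < N" using assms J_less by auto
  have tie: "e l = e i" if "i \<le> l" "l \<le> j" for l
  proof (rule ties)
    show "s l = s i" using mono[of i l] mono[of l j] that jN eq by simp
  qed (use that jN assms in auto)
  have eqe: "e i = e j" using tie[of j] assms by simp
  then have same: "u i = u j"
    using up_iff[OF assms(1)] up_iff[OF assms(2)] assms unfolding J_def by auto
  have unit: "if e i then u l = Suc (u (Suc l)) else u (Suc l) = Suc (u l)" if "i \<le> l" "l < j" for l
    using u_Suc[of l] tie[of l] that jN by simp
  show False
  proof (cases "e i")
    case True
    have "l \<le> j \<Longrightarrow> u l + l = u i + i" if "i \<le> l" for l
      using that
    proof (induction l rule: dec_induct)
      case (step n)
      then have "u n = Suc (u (Suc n))" using unit[of n] True by simp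
      then show ?case using step by simp
    qed simp
    from this[of j] show False using same assms(3) by simp
  next
    case False
    have "l \<le> j \<Longrightarrow> u l + i = u i + l" if "i \<le> l" for l
      using that
    proof (induction l rule: dec_induct)
      case (step n)
      then have "u (Suc n) = Suc (u n)" using unit[of n] False by simp
      then show ?case using step by simp
    qed simp
    from this[of j] show False using same assms(3) by simp
  qed
qed

lemma s_less: "i \<in> J \<Longrightarrow> j \<in> J \<Longrightarrow> i < j \<Longrightarrow> s i < s j"
  using s_neq[of i j] mono[of i j] J_less[of j] by (simp add: order_less_le)

lemma inj_on_s: "inj_on s J"
  using s_neq by (metis inj_onI linorder_neqE_nat)

text \<open>The negative factors belong to the selected indices above \<open>j\<close>. As
  \<open>card J\<close> is odd, their number has the parity of the number below \<open>j\<close>,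
  which by \<open>crossings\<close> is even exactly when \<open>j\<close> is an up crossing.\<close>

lemma sgn_weight:
  assumes j: "j \<in> J"
  shows "sgn (\<Prod>i\<in>J - {j}. s j - s i) = (if e j then -1 else 1)"
proof -
  have lt: "s j - s i < 0 \<longleftrightarrow> j < i" if "i \<in> J - {j}" for i
    using s_less[of i j] s_less[of j i] that j by (metis DiffD1 DiffD2 diff_less_0_iff_less insertI1 linorder_neqE_nat order.asym)
  have "sgn (\<Prod>i\<in>J - {j}. s j - s i) = (-1) ^ card {i\<in>J - {j}. s j - s i < 0}"
    using finite_J j inj_on_s by (intro sgn_prod_eq) (auto simp: inj_on_def)
  also have "{i\<in>J - {j}. s j - s i < 0} = {i\<in>J. j < i}" using lt by auto
  also have "(-1::real) ^ card {i\<in>J. j < i} = (if e j then -1 else 1)"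
  proof -
    have "J = insert j ({i\<in>J. i < j} \<union> {i\<in>J. j < i})" using j by auto
    then have "card J = card (insert j ({i\<in>J. i < j} \<union> {i\<in>J. j < i}))" by (rule arg_cong)
    moreover have "card (insert j ({i\<in>J. i < j} \<union> {i\<in>J. j < i}))
        = Suc (card ({i\<in>J. i < j} \<union> {i\<in>J. j < i}))"
      using finite_J by (intro card_insert_disjoint) auto
    moreover have "card ({i\<in>J. i < j} \<union> {i\<in>J. j < i}) = card {i\<in>J. i < j} + card {i\<in>J. j < i}"
      using finite_J by (intro card_Un_disjoint) auto
    ultimately have "card J = Suc (card {i\<in>J. i < j} + card {i\<in>J. j < i})" by (simp only:)
    then have a: "card {i\<in>J. i < j} + card {i\<in>J. j < i} = 2 * card {j\<in>J. e j}" using card_J by simp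
    have "{i\<in>J. i < j} = {i\<in>J. i < j \<and> e i} \<union> {i\<in>J. i < j \<and> \<not> e i}" by auto
    then have "card {i\<in>J. i < j} = card {i\<in>J. i < j \<and> e i} + card {i\<in>J. i < j \<and> \<not> e i}"
      using finite_J by (subst card_Un_disjoint[symmetric]) auto
    also have "\<dots> = 2 * card {i\<in>J. i < j \<and> e i} + (if u j > k then 1 else 0)"
      using crossings[of j] J_less[OF j] by simp
    finally have "even (card {i\<in>J. i < j}) \<longleftrightarrow> \<not> u j > k" by simp
    also have "\<not> u j > k \<longleftrightarrow> u j = k" using lower[of j] J_less[OF j] by linarith
    also have "even (card {i\<in>J. i < j}) \<longleftrightarrow> even (card {i\<in>J. j < i})"
      using arg_cong[OF a, of even] by simp
    finally have "even (card {i\<in>J. j < i}) \<longleftrightarrow> \<not> e j" using up_iff[OF j] by blast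
    then show ?thesis by simp
  qed
  finally show ?thesis .
qed

end

section \<open>Generic directions and balanced subsets of the plane\<close>

text \<open>For a finite \<open>D\<close> without \<open>0\<close> this excludes finitely many lines
  through the origin, an elementary form of "almost every direction" in which \<open>D\<close> can
  grow along an induction.\<close>

definition generic :: "complex set \<Rightarrow> complex \<Rightarrow> bool" where
  "generic D z \<longleftrightarrow> (\<forall>d\<in>D. Re (cnj z * d) \<noteq> 0)"

lemma generic_uminus [simp]: "generic D (- z) \<longleftrightarrow> generic D z"
  by (auto simp: generic_def)

lemma generic_Un: "generic (D \<union> E) z \<longleftrightarrow> generic D z \<and> generic E z"
  by (auto simp: generic_def)

text \<open>As \<open>t\<close> runs through the reals, \<open>z * Complex (- t) 1\<close> turns
  from the direction of \<open>z\<close> towards \<open>- z\<close>, and each \<open>d\<close> in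
  \<open>D\<close> is perpendicular to it for at most one \<open>t\<close>.\<close>

lemma ex_generic_in_interval:
  assumes D: "finite D" "0 \<notin> D" and z: "z \<noteq> 0" and ab: "a < b"
  shows "\<exists>t. a < t \<and> t < b \<and> generic D (z * Complex (- t) 1)"
proof -
  have "{t. \<not> generic D (z * Complex (- t) 1)} \<subseteq> (\<lambda>d. Im (cnj z * d) / Re (cnj z * d)) ` D"
  proof
    fix t assume "t \<in> {t. \<not> generic D (z * Complex (- t) 1)}"
    then obtain d where d: "d \<in> D" "Re (cnj (z * Complex (- t) 1) * d) = 0"
      by (auto simp: generic_def)
    define w where "w = cnj z * d"
    have "cnj (z * Complex (- t) 1) * d = Complex (- t) (- 1) * w"
      by (simp add: w_def complex_eq_iff algebra_simps)
    then have eq: "Im w = t * Re w" using d by simp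
    have "w \<noteq> 0" using d D z by (auto simp: w_def)
    then have "Re w \<noteq> 0" using eq by (auto simp: complex_eq_iff)
    then show "t \<in> (\<lambda>d. Im (cnj z * d) / Re (cnj z * d)) ` D"
      using eq d by (intro image_eqI[of _ _ d]) (auto simp: w_def)
  qed
  then have "finite {t. \<not> generic D (z * Complex (- t) 1)}"
    by (rule finite_subset) (use D in auto)
  then have "\<not> {a<..<b} \<subseteq> {t. \<not> generic D (z * Complex (- t) 1)}"
    using ab infinite_Ioo finite_subset by blast
  then show ?thesis by auto
qed

lemma finite_separation:
  fixes t :: real
  assumes "finite F"
  shows "\<exists>g>0. \<forall>x\<in>F. x \<noteq> t \<longrightarrow> g < \<bar>x - t\<bar>"
  using assms
proof (induction F rule: finite_induct)
  case empty show ?case by (intro exI[of _ 1]) auto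
next
  case (insert y F)
  then obtain g where g: "g > 0" "\<forall>x\<in>F. x \<noteq> t \<longrightarrow> g < \<bar>x - t\<bar>" by auto
  show ?case
    by (rule exI[of _ "if y = t then g else min g (\<bar>y - t\<bar> / 2)"]) (use g in \<open>auto simp: min_def\<close>)
qed

lemma ex_sorted_enumeration:
  fixes s :: "'a \<Rightarrow> real"
  assumes "finite X"
  obtains h where "bij_betw h {..<card X} X" "\<And>i j. i \<le> j \<Longrightarrow> j < card X \<Longrightarrow> s (h i) \<le> s (h j)"
proof -
  obtain xs0 where xs0: "set xs0 = X" "distinct xs0" using finite_distinct_list[OF assms] by auto
  define xs where "xs = sort_key s xs0"
  have xs: "set xs = X" "distinct xs" "sorted (map s xs)" using xs0 by (auto simp: xs_def)
  have len: "length xs = card X" using xs distinct_card by metis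
  show ?thesis
  proof
    show "bij_betw ((!) xs) {..<card X} X" using bij_betw_nth[OF xs(2)] len xs(1) by simp
    show "s (xs ! i) \<le> s (xs ! j)" if "i \<le> j" "j < card X" for i j
      using sorted_nth_mono[OF xs(3), of i j] that len by simp
  qed
qed

lemma Re_mult_of_real: "Re (of_real a * x) = a * Re x"
  by simp

text \<open>Rotating a half-plane with fewest points through a half turn gives a
  \<open>sign_walk\<close>, whose crossings form the subset. Their alternation lets positive weights
  reproduce the Lagrange denominators, hence the vanishing moments; \<open>count_J\<close> bounds
  what their removal costs.\<close>

lemma balanced_subset:
  fixes c :: "'a \<Rightarrow> complex"
  assumes X: "finite X" "X \<noteq> {}" and c0: "\<And>x. x \<in> X \<Longrightarrow> c x \<noteq> 0"
    and anti: "\<And>x y t. x \<in> X \<Longrightarrow> y \<in> X \<Longrightarrow> t > 0 \<Longrightarrow> c x \<noteq> - of_real t * c y"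
    and D: "finite D" "0 \<notin> D"
    and count: "\<And>z. generic D z \<Longrightarrow> k \<le> card {x\<in>X. Re (cnj z * c x) > 0}"
  obtains J r and \<omega> s :: "'a \<Rightarrow> real" and D'
  where "J \<subseteq> X" "card J = 2 * r + 1" "inj_on s J" "\<And>x. x \<in> J \<Longrightarrow> \<omega> x > 0"
    "\<And>m. m + 2 \<le> 2 * r \<Longrightarrow> (\<Sum>x\<in>J. of_real (\<omega> x * s x ^ m) * c x) = 0"
    "finite D'" "0 \<notin> D'"
    "\<And>z. generic D' z \<Longrightarrow> k - r \<le> card {x\<in>X - J. Re (cnj z * c x) > 0}"
proof -
  \<comment> \<open>Including the points keeps them off the boundary lines, so opposite half-planes
    hold complementary sets.\<close>
  define D0 where "D0 = D \<union> c ` X"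
  have D0: "finite D0" "0 \<notin> D0" using X D c0 by (auto simp: D0_def)
  define N where "N = card X"
  have Npos: "N > 0" using X by (auto simp: N_def card_gt_0_iff)
  define cnt where "cnt z = card {x\<in>X. Re (cnj z * c x) > 0}" for z
  have "\<exists>z. generic D0 z" using ex_generic_in_interval[OF D0, of 1 0 1] by auto
  \<comment> \<open>Minimality makes \<open>k0\<close> a lower bound for all generic counts; through
    opposite half-planes it also gives the upper bound \<open>N - k0\<close>.\<close>
  then obtain z0 where z0: "generic D0 z0" and z0min: "\<And>z. generic D0 z \<Longrightarrow> cnt z0 \<le> cnt z"
    using ex_has_least_nat[of "generic D0" _ cnt] by blast
  define k0 where "k0 = cnt z0"
  have kk0: "k \<le> k0" using count[of z0] z0 by (auto simp: k0_def cnt_def D0_def generic_Un)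
  have z0nz: "z0 \<noteq> 0" using z0 X by (auto simp: generic_def D0_def)
  have neg_cnt: "cnt (- z) = N - cnt z" if z: "generic D0 z" for z
  proof -
    have "{x\<in>X. Re (cnj (- z) * c x) > 0} = X - {x\<in>X. Re (cnj z * c x) > 0}"
      using z by (auto simp: generic_def D0_def) (smt (verit) UnI2 imageI)
    then show ?thesis using X by (simp add: cnt_def N_def card_Diff_subset)
  qed
  have cntN: "cnt z \<le> N" for z unfolding cnt_def N_def using X by (intro card_mono) auto
  have cnt_upper: "cnt z \<le> N - k0" if "generic D0 z" for z
    using neg_cnt[OF that] z0min[of "- z"] that cntN[of z] unfolding k0_def by simp
  define w where "w x = cnj z0 * c x" for x
  \<comment> \<open>The value of \<open>t\<close> at which the boundary of the half-plane in
    direction \<open>z0 * Complex (- t) 1\<close> passes through \<open>c x\<close>, as the factor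
    \<open>sl x - t\<close> in \<open>key\<close> shows.\<close>
  define sl where "sl x = Im (w x) / Re (w x)" for x
  define up where "up x \<longleftrightarrow> Re (w x) > 0" for x
  have Rew: "Re (w x) \<noteq> 0" if "x \<in> X" for x using z0 that by (auto simp: generic_def D0_def w_def)
  have weq: "w x = of_real (Re (w x)) * Complex 1 (sl x)" if "x \<in> X" for x
    using Rew[OF that] by (simp add: complex_eq_iff sl_def)
  have key: "Re (cnj (of_real b * (z0 * Complex (- t) 1)) * c x) = b * (Re (w x) * (sl x - t))"
    if "x \<in> X" for b t x
  proof -
    have "cnj (of_real b * (z0 * Complex (- t) 1)) * c x = of_real b * (Complex (- t) (- 1) * w x)"
      by (simp add: w_def complex_eq_iff algebra_simps)
    also have "Re \<dots> = b * (Re (w x) * (sl x - t))"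
      using Rew[OF that] by (simp add: sl_def field_simps)
    finally show ?thesis .
  qed
  obtain h where h: "bij_betw h {..<N} X" and hmono: "\<And>i j. i \<le> j \<Longrightarrow> j < N \<Longrightarrow> sl (h i) \<le> sl (h j)"
    using ex_sorted_enumeration[OF X(1), of sl] unfolding N_def by metis
  have hX: "h j \<in> X" if "j < N" for j using h that by (auto simp: bij_betw_def)
  have hinj: "inj_on h {..<N}" using h by (simp add: bij_betw_def)
  have cardh: "card {x\<in>h ` A. Q x} = card {j\<in>A. Q (h j)}" if "A \<subseteq> {..<N}" for A Q
  proof -
    have "{x\<in>h ` A. Q x} = h ` {j\<in>A. Q (h j)}" by auto
    moreover have "inj_on h {j\<in>A. Q (h j)}" by (rule inj_on_subset[OF hinj]) (use that in auto)
    ultimately show ?thesis by (simp add: card_image)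
  qed
  have hXeq: "h ` {..<N} = X" using h by (simp add: bij_betw_def)
  define e where "e j = up (h j)" for j
  define s where "s j = sl (h j)" for j
  have sgnkey: "Re (cnj (z0 * Complex (- t) 1) * c (h j)) > 0 \<longleftrightarrow> (if e j then t < s j else s j < t)"
    if "j < N" for t j
    using key[OF hX[OF that], of 1 t] Rew[OF hX[OF that]]
    by (auto simp: e_def up_def s_def zero_less_mult_iff)
  have cnt_line: "cnt (z0 * Complex (- t) 1) = card {j. j < N \<and> (if e j then t < s j else s j < t)}" for t
  proof -
    have "cnt (z0 * Complex (- t) 1) = card {j\<in>{..<N}. Re (cnj (z0 * Complex (- t) 1) * c (h j)) > 0}"
      unfolding cnt_def using cardh[of "{..<N}"] hXeq by simp
    also have "{j\<in>{..<N}. Re (cnj (z0 * Complex (- t) 1) * c (h j)) > 0} =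
        {j. j < N \<and> (if e j then t < s j else s j < t)}"
      using sgnkey by blast
    finally show ?thesis .
  qed
  have smono: "s i \<le> s j" if "i \<le> j" "j < N" for i j using hmono that by (simp add: s_def)
  \<comment> \<open>Points of equal slope with different starting sides would lie in opposite
    directions, which \<open>anti\<close> excludes.\<close>
  have ties: "e i = e j" if "i < N" "j < N" "s i = s j" for i j
  proof -
    have *: False if "i < N" "j < N" "s i = s j" "e i" "\<not> e j" for i j
    proof -
      define t where "t = - Re (w (h i)) / Re (w (h j))"
      have neg: "Re (w (h j)) < 0" using that Rew[OF hX[OF that(2)]] by (auto simp: e_def up_def)
      have "t > 0" using that neg by (auto simp: t_def e_def up_def divide_simps)
      have "w (h i) = - of_real t * w (h j)"
        using neg that by (subst (1 2) weq) (auto simp: t_def s_def hX complex_eq_iff)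
      then have "cnj z0 * c (h i) = cnj z0 * (- of_real t * c (h j))" by (simp add: w_def)
      then have "c (h i) = - of_real t * c (h j)"
        using z0nz by (metis complex_cnj_zero_iff mult_cancel_left)
      then show False using anti[OF hX[OF that(1)] hX[OF that(2)] \<open>t > 0\<close>] by simp
    qed
    then show ?thesis using that by metis
  qed
  have u0: "flip_count N e 0 = k0"
  proof -
    have "k0 = card {x\<in>h ` {..<N}. Re (cnj z0 * c x) > 0}" unfolding k0_def cnt_def hXeq ..
    also have "\<dots> = card {j\<in>{..<N}. Re (cnj z0 * c (h j)) > 0}" by (rule cardh) simp
    finally show ?thesis by (simp add: flip_count_def e_def up_def w_def)
  qed
  have uN: "flip_count N e N = N - k0"
  proof -
    have "{j. j < N \<and> (if j < N then \<not> e j else e j)} = {..<N} - {j. j < N \<and> e j}" by auto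
    then have "flip_count N e N = N - card {j. j < N \<and> e j}"
      unfolding flip_count_def by (simp, subst card_Diff_subset) auto
    then show ?thesis using u0 unfolding flip_count_def by simp
  qed
  \<comment> \<open>A generic parameter so close to \<open>s m\<close> that no other slope lies
    between; \<open>b\<close> chooses the side.\<close>
  have near: "\<exists>t. generic D0 (z0 * Complex (- t) 1) \<and> (if b then s m < t else t < s m) \<and>
      (\<forall>j<N. s j \<noteq> s m \<longrightarrow> (s j < t \<longleftrightarrow> s j < s m) \<and> (t < s j \<longleftrightarrow> s m < s j))" for m b
  proof -
    obtain g where g: "g > 0" "\<forall>x\<in>s ` {..<N}. x \<noteq> s m \<longrightarrow> g < \<bar>x - s m\<bar>"
      using finite_separation[of "s ` {..<N}" "s m"] by auto
    define a b' where "a = (if b then s m else s m - g)" and "b' = (if b then s m + g else s m)"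
    have "a < b'" using g by (auto simp: a_def b'_def)
    from ex_generic_in_interval[OF D0 z0nz this] obtain t
      where t: "a < t" "t < b'" "generic D0 (z0 * Complex (- t) 1)" by auto
    have "\<bar>t - s m\<bar> < g" "if b then s m < t else t < s m"
      using t by (auto simp: a_def b'_def split: if_splits)
    moreover have "(s j < t \<longleftrightarrow> s j < s m) \<and> (t < s j \<longleftrightarrow> s m < s j)" if "j < N" "s j \<noteq> s m" for j
    proof -
      have "g < \<bar>s j - s m\<bar>" using g that by auto
      then show ?thesis using \<open>\<bar>t - s m\<bar> < g\<close> by linarith
    qed
    ultimately show ?thesis using t(3) by blast
  qed
  \<comment> \<open>Within a block of equal slopes \<open>flip_count\<close> need not be the count
    of a half-plane. On the side of \<open>s m\<close> where the whole block is switched off, a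
    genuine half-plane holds only points counted here, and minimality applies.\<close>
  have lower: "k0 \<le> flip_count N e m" if "m \<le> N" for m
  proof (cases "m = N")
    case True
    then show ?thesis using uN cnt_upper[OF z0] by (simp add: k0_def)
  next
    case False
    then have m: "m < N" using that by simp
    obtain t where t: "generic D0 (z0 * Complex (- t) 1)" "if e m then s m < t else t < s m"
      and tj: "\<And>j. j < N \<Longrightarrow> s j \<noteq> s m \<Longrightarrow> (s j < t \<longleftrightarrow> s j < s m) \<and> (t < s j \<longleftrightarrow> s m < s j)"
      using near[of "e m" m] by blast
    have "{j. j < N \<and> (if e j then t < s j else s j < t)}
        \<subseteq> {j. j < N \<and> (if j < m then \<not> e j else e j)}"
    proof clarify
      fix j assume j: "j < N" "if e j then t < s j else s j < t"
      have ne: "s j \<noteq> s m"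
        using t(2) j ties[OF j(1) m] by (auto split: if_splits)
      have "s j \<le> s m \<or> \<not> j < m" "s m \<le> s j \<or> j < m" using smono[of j m] smono[of m j] m j by auto
      then show "if j < m then \<not> e j else e j" using j(2) tj[OF j(1) ne] ne by (auto split: if_splits)
    qed
    then have "cnt (z0 * Complex (- t) 1) \<le> flip_count N e m"
      unfolding cnt_line flip_count_def by (intro card_mono) auto
    then show ?thesis using z0min[OF t(1)] by (simp add: k0_def)
  qed
  \<comment> \<open>Now the block of index \<open>0\<close> is switched on, so a genuine half-plane
    holds all points counted after the first step.\<close>
  have upper: "flip_count N e (Suc 0) \<le> flip_count N e N"
  proof -
    obtain t where t: "generic D0 (z0 * Complex (- t) 1)" "if \<not> e 0 then s 0 < t else t < s 0"
      and tj: "\<And>j. j < N \<Longrightarrow> s j \<noteq> s 0 \<Longrightarrow> (s j < t \<longleftrightarrow> s j < s 0) \<and> (t < s j \<longleftrightarrow> s 0 < s j)"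
      using near[of "\<not> e 0" 0] by blast
    have "{j. j < N \<and> (if j < Suc 0 then \<not> e j else e j)}
        \<subseteq> {j. j < N \<and> (if e j then t < s j else s j < t)}"
    proof clarify
      fix j assume j: "j < N" "if j < Suc 0 then \<not> e j else e j"
      show "if e j then t < s j else s j < t"
      proof (cases "s j = s 0")
        case True
        then have "e j = e 0" using ties[OF j(1) Npos] by simp
        then show ?thesis using True t(2) by auto
      next
        case False
        then have "j \<noteq> 0" by metis
        moreover have "s 0 < s j" using smono[of 0 j] j False by simp
        ultimately show ?thesis using j tj[OF j(1) False] by (auto split: if_splits)
      qed
    qed
    then have "flip_count N e (Suc 0) \<le> cnt (z0 * Complex (- t) 1)"
      unfolding cnt_line flip_count_def by (intro card_mono) auto
    then show ?thesis using cnt_upper[OF t(1)] uN by simp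
  qed
  interpret sign_walk N k0 e s
    by unfold_locales (fact Npos smono ties u0 lower upper)+
  define r where "r = card {j\<in>J. e j}"
  have JN: "J \<subseteq> {..<N}" using J_less by auto
  have hJ: "inj_on h J" using hinj JN by (rule inj_on_subset)
  define K where "K = h ` J"
  have KX: "K \<subseteq> X" using JN hX by (auto simp: K_def)
  have cardK: "card K = 2 * r + 1" using card_J card_image[OF hJ] by (simp add: K_def r_def)
  have injK: "inj_on sl K"
    using inj_on_s hJ unfolding K_def s_def by (auto simp: inj_on_def)
  define q where "q x = (\<Prod>y\<in>K - {x}. sl x - sl y)" for x
  have q: "sgn (q x) = (if up x then -1 else 1)" if "x \<in> K" for x
  proof -
    obtain j where j: "j \<in> J" "x = h j" using \<open>x \<in> K\<close> by (auto simp: K_def)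
    have "K - {x} = h ` (J - {j})" using hJ j by (auto simp: K_def inj_on_def)
    moreover have "inj_on h (J - {j})" using hJ by (rule inj_on_subset) auto
    ultimately have "q x = (\<Prod>i\<in>J - {j}. s j - s i)" by (simp add: q_def prod.reindex j s_def)
    then show ?thesis using sgn_weight[OF j(1)] by (simp add: j e_def)
  qed
  \<comment> \<open>The absolute value of \<open>1 / (Re (w x) * q x)\<close>. By \<open>q\<close>
    the two factors have opposite signs, so that \<open>\<omega> x * Re (w x)\<close> becomes
    \<open>- 1 / q x\<close>.\<close>
  define \<omega> where "\<omega> x = 1 / (\<bar>Re (w x)\<bar> * \<bar>q x\<bar>)" for x
  have qne: "q x \<noteq> 0" if "x \<in> K" for x using q[OF that] by (auto split: if_splits)
  have \<omega>pos: "\<omega> x > 0" if "x \<in> K" for x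
    using qne[OF that] Rew that KX by (auto simp: \<omega>_def)
  have \<omega>w: "\<omega> x * Re (w x) = - 1 / q x" if "x \<in> K" for x
    using q[OF that] Rew[of x] that KX
    by (auto simp: \<omega>_def up_def sgn_if abs_if field_simps split: if_splits)
  have moment0: "(\<Sum>x\<in>K. sl x ^ m / q x) = 0" if "m + 2 \<le> 2 * r + 1" for m
    unfolding q_def using KX X injK cardK that by (intro lagrange_moments) (auto intro: finite_subset)
  \<comment> \<open>After multiplication by \<open>cnj z0\<close> the real part is a Lagrange moment
    of order \<open>m\<close> and the imaginary part one of order \<open>Suc m\<close>. The latter
    explains the bound \<open>2 * r\<close> in spite of \<open>2 * r + 1\<close> nodes.\<close>
  have moment: "(\<Sum>x\<in>K. of_real (\<omega> x * sl x ^ m) * c x) = 0" if m: "m + 2 \<le> 2 * r" for m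
  proof -
    have "cnj z0 * (of_real (\<omega> x * sl x ^ m) * c x)
        = of_real (- (sl x ^ m / q x)) + \<i> * of_real (- (sl x ^ Suc m / q x))" if "x \<in> K" for x
    proof -
      have "cnj z0 * (of_real (\<omega> x * sl x ^ m) * c x) = of_real (\<omega> x * sl x ^ m) * w x"
        by (simp add: w_def)
      also have "\<dots> = of_real (\<omega> x * Re (w x) * sl x ^ m) * Complex 1 (sl x)"
        using that KX by (subst weq) auto
      also have "\<dots> = of_real (- (sl x ^ m / q x)) + \<i> * of_real (- (sl x ^ Suc m / q x))"
        unfolding \<omega>w[OF that] by (simp add: complex_eq_iff)
      finally show ?thesis .
    qed
    then have "cnj z0 * (\<Sum>x\<in>K. of_real (\<omega> x * sl x ^ m) * c x)
       = (\<Sum>x\<in>K. of_real (- (sl x ^ m / q x)) + \<i> * of_real (- (sl x ^ Suc m / q x)))"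
      by (simp add: sum_distrib_left)
    also have "\<dots> = of_real (- (\<Sum>x\<in>K. sl x ^ m / q x)) + \<i> * of_real (- (\<Sum>x\<in>K. sl x ^ Suc m / q x))"
      by (simp only: sum.distrib sum_distrib_left[symmetric] of_real_sum[symmetric] sum_negf)
    also have "\<dots> = 0" using moment0[of m] moment0[of "Suc m"] m by simp
    finally show ?thesis using z0nz by simp
  qed
  \<comment> \<open>This excludes the real multiples of \<open>z0\<close>; every other direction is
    a real multiple of some \<open>z0 * Complex (- t) 1\<close>.\<close>
  define D' where "D' = insert (\<i> * z0) D0"
  have D': "finite D'" "0 \<notin> D'" using D0 z0nz by (auto simp: D'_def)
  have rest: "k - r \<le> card {x\<in>X - K. Re (cnj z * c x) > 0}" if z: "generic D' z" for z
  proof -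
    define b where "b = Im (z / z0)"
    define t where "t = - Re (z / z0) / b"
    have "cnj z * (\<i> * z0) = of_real ((cmod z0)\<^sup>2) * (\<i> * cnj (z / z0))"
      using z0nz by (simp add: complex_norm_square field_simps del: of_real_power)
    also have "Re \<dots> = (cmod z0)\<^sup>2 * b"
      by (subst Re_mult_of_real) (simp add: b_def del: complex_cnj_divide)
    finally have "Re (cnj z * (\<i> * z0)) = (cmod z0)\<^sup>2 * b" .
    then have b: "b \<noteq> 0" using z by (auto simp: generic_def D'_def)
    have "of_real b * Complex (- t) 1 = z / z0" using b by (simp add: complex_eq_iff t_def b_def)
    then have zeq: "z = of_real b * (z0 * Complex (- t) 1)" using z0nz by (simp add: field_simps)
    have zgen: "generic D0 z" using z by (auto simp: generic_def D'_def)
    have snt: "s j \<noteq> t" if "j < N" for j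
    proof
      assume "s j = t"
      then have "Re (cnj z * c (h j)) = 0" unfolding zeq by (subst key) (auto simp: hX that s_def)
      then show False using zgen hX[OF that] by (auto simp: generic_def D0_def)
    qed
    define m where "m = (LEAST m. m = N \<or> t \<le> s m)"
    have m: "m = N \<or> t \<le> s m" unfolding m_def by (rule LeastI[of _ N]) simp
    have mN: "m \<le> N" unfolding m_def by (rule Least_le) simp
    have jm: "j < m \<longleftrightarrow> s j < t" if "j < N" for j
    proof
      assume "j < m"
      then show "s j < t" using not_less_Least[of j "\<lambda>m. m = N \<or> t \<le> s m"] that by (auto simp: m_def)
    next
      assume "s j < t"
      then show "j < m" using m smono[of m j] that by force
    qed
    have pos: "Re (cnj z * c (h j)) > 0 \<longleftrightarrow> (if b > 0 then (if j < m then \<not> e j else e j)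
       else \<not> (if j < m then \<not> e j else e j))" if "j < N" for j
    proof -
      have "Re (cnj z * c (h j)) = b * (Re (w (h j)) * (s j - t))"
        unfolding zeq by (subst key) (auto simp: hX that s_def)
      then show ?thesis
        using b Rew[OF hX[OF that]] jm[OF that] snt[OF that]
        by (auto simp: e_def up_def zero_less_mult_iff mult_less_0_iff)
    qed
    have tot: "card {x\<in>X. Re (cnj z * c x) > 0} = (if b > 0 then u m else N - u m)"
    proof -
      have "card {x\<in>X. Re (cnj z * c x) > 0} = card {j\<in>{..<N}. Re (cnj z * c (h j)) > 0}"
        using cardh[of "{..<N}"] hXeq by simp
      also have "{j\<in>{..<N}. Re (cnj z * c (h j)) > 0} = (if b > 0 then {j. j < N \<and> (if j < m then \<not> e j else e j)}
           else {..<N} - {j. j < N \<and> (if j < m then \<not> e j else e j)})"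
        using pos by (auto split: if_splits)
      also have "card \<dots> = (if b > 0 then u m else N - u m)"
      proof (cases "b > 0")
        case False
        have "card ({..<N} - {j. j < N \<and> (if j < m then \<not> e j else e j)}) = N - u m"
          unfolding flip_count_def by (subst card_Diff_subset) auto
        then show ?thesis using False by simp
      qed (simp add: flip_count_def)
      finally show ?thesis .
    qed
    have part: "card {x\<in>K. Re (cnj z * c x) > 0} =
        (if b > 0 then r + (if u m > k0 then 1 else 0) else r + 1 - (if u m > k0 then 1 else 0))"
    proof -
      have "card {x\<in>K. Re (cnj z * c x) > 0} = card {j\<in>J. Re (cnj z * c (h j)) > 0}"
        unfolding K_def using JN by (rule cardh)
      also have "{j\<in>J. Re (cnj z * c (h j)) > 0} = (if b > 0 then {j\<in>J. if j < m then \<not> e j else e j}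
           else J - {j\<in>J. if j < m then \<not> e j else e j})"
        using pos J_less by (auto split: if_splits)
      also have "card \<dots> = (if b > 0 then card {j\<in>J. if j < m then \<not> e j else e j}
           else card J - card {j\<in>J. if j < m then \<not> e j else e j})"
        using finite_J by (simp add: card_Diff_subset)
      finally show ?thesis unfolding count_J[OF mN] card_J by (simp add: r_def)
    qed
    have "{x\<in>X. Re (cnj z * c x) > 0} = {x\<in>K. Re (cnj z * c x) > 0} \<union> {x\<in>X - K. Re (cnj z * c x) > 0}"
      using KX by auto
    moreover have "finite K" using KX X by (auto intro: finite_subset)
    ultimately have split: "card {x\<in>X. Re (cnj z * c x) > 0} =
        card {x\<in>K. Re (cnj z * c x) > 0} + card {x\<in>X - K. Re (cnj z * c x) > 0}"
      using X by (simp, subst card_Un_disjoint) auto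
    have "k0 \<le> card {x\<in>X. Re (cnj z * c x) > 0}" using z0min[OF zgen] by (simp add: k0_def cnt_def)
    \<comment> \<open>For \<open>b > 0\<close> the loss is \<open>r + 1\<close> only if
      \<open>u m > k0\<close>. For \<open>b < 0\<close> it is \<open>r + 1\<close> only if
      \<open>u m = k0\<close>, and then the half-plane holds \<open>N - k0\<close> points, more than
      \<open>k0\<close> by \<open>stop\<close>.\<close>
    then have "k0 - r \<le> card {x\<in>X - K. Re (cnj z * c x) > 0}"
    proof -
      define i :: nat where "i = (if u m > k0 then 1 else 0)"
      have i: "i = 1 \<and> u m > k0 \<or> i = 0 \<and> u m = k0" using lower[OF mN] by (auto simp: i_def)
      show ?thesis
      proof (cases "b > 0")
        case True
        then have "card {x\<in>X. Re (cnj z * c x) > 0} = u m" "card {x\<in>K. Re (cnj z * c x) > 0} = r + i"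
          using tot part by (simp_all add: i_def)
        then show ?thesis using split i by linarith
      next
        case False
        then have "card {x\<in>X. Re (cnj z * c x) > 0} = N - u m" "card {x\<in>K. Re (cnj z * c x) > 0} = r + 1 - i"
          using tot part by (simp_all add: i_def)
        then show ?thesis
          using split i stop uN \<open>k0 \<le> card {x\<in>X. Re (cnj z * c x) > 0}\<close> by linarith
      qed
    qed
    then show ?thesis using kk0 by simp
  qed
  show ?thesis
    by (rule that[of K r sl \<omega> D']) (use KX cardK injK \<omega>pos moment D' rest in auto)
qed

section \<open>Linear algebra\<close>

text \<open>If the matrix of \<open>M\<close> is singular, \<open>a = 1\<close> and
  \<open>b = 0\<close> work. Otherwise an eigenvalue \<open>l\<close> of its inverse times the
  matrix of \<open>M'\<close> makes \<open>l M - M'\<close> singular.\<close>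

lemma ex_singular_combination:
  fixes M M' :: "nat \<Rightarrow> nat \<Rightarrow> complex"
  assumes n: "n > 0"
  shows "\<exists>a b c. (a \<noteq> 0 \<or> b \<noteq> 0) \<and> (\<exists>j<n. c j \<noteq> 0) \<and>
    (\<forall>i<n. (\<Sum>j<n. (a * M i j + b * M' i j) * c j) = 0)"
proof -
  define A B where "A = mat n n (\<lambda>(i, j). M i j)" and "B = mat n n (\<lambda>(i, j). M' i j)"
  have AB: "A \<in> carrier_mat n n" "B \<in> carrier_mat n n" by (auto simp: A_def B_def)
  have "\<exists>a b v. (a \<noteq> 0 \<or> b \<noteq> 0) \<and> v \<in> carrier_vec n \<and> v \<noteq> 0\<^sub>v n \<and>
    a \<cdot>\<^sub>v (A *\<^sub>v v) + b \<cdot>\<^sub>v (B *\<^sub>v v) = 0\<^sub>v n"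
  proof (cases "det A = 0")
    case True
    then obtain v where v: "v \<in> carrier_vec n" "v \<noteq> 0\<^sub>v n" "A *\<^sub>v v = 0\<^sub>v n"
      using det_0_iff_vec_prod_zero[OF AB(1)] by auto
    have "1 \<cdot>\<^sub>v (A *\<^sub>v v) + 0 \<cdot>\<^sub>v (B *\<^sub>v v) = 0\<^sub>v n" using v AB by (intro eq_vecI) auto
    then show ?thesis using v by (intro exI[of _ 1] exI[of _ 0] exI[of _ v]) auto
  next
    case False
    then obtain C where C: "C \<in> carrier_mat n n" "A * C = 1\<^sub>m n"
      using det_non_zero_imp_unit[OF AB(1) False] unfolding Units_def ring_mat_def by auto
    have CB: "C * B \<in> carrier_mat n n" using C AB by simp
    have "degree (char_poly (C * B)) = n" using degree_monic_char_poly[OF CB] by simp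
    then have "\<not> constant (poly (char_poly (C * B)))" using n by (simp add: constant_degree)
    then obtain l where "poly (char_poly (C * B)) l = 0"
      using fundamental_theorem_of_algebra by blast
    then have "eigenvalue (C * B) l" using eigenvalue_root_char_poly[OF CB] by simp
    then obtain v where v: "v \<in> carrier_vec n" "v \<noteq> 0\<^sub>v n" "(C * B) *\<^sub>v v = l \<cdot>\<^sub>v v"
      unfolding eigenvalue_def eigenvector_def using C by auto
    have "A *\<^sub>v (l \<cdot>\<^sub>v v) = A *\<^sub>v ((C * B) *\<^sub>v v)" using v by simp
    also have "\<dots> = (A * (C * B)) *\<^sub>v v" by (rule assoc_mult_mat_vec[symmetric, OF AB(1) CB v(1)])
    also have "A * (C * B) = B" using assoc_mult_mat[OF AB(1) C(1) AB(2)] C AB by simp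
    finally have "l \<cdot>\<^sub>v (A *\<^sub>v v) = B *\<^sub>v v" using v AB by (simp add: mult_mat_vec)
    moreover have "B *\<^sub>v v \<in> carrier_vec n" using mult_mat_vec_carrier[OF AB(2) v(1)] .
    ultimately have "l \<cdot>\<^sub>v (A *\<^sub>v v) + (- 1) \<cdot>\<^sub>v (B *\<^sub>v v) = 0\<^sub>v n"
      using AB by (intro eq_vecI) auto
    then show ?thesis using v by (intro exI[of _ l] exI[of _ "- 1"] exI[of _ v]) auto
  qed
  then obtain a b v where ab: "a \<noteq> 0 \<or> b \<noteq> 0" and v: "v \<in> carrier_vec n" "v \<noteq> 0\<^sub>v n"
    and eq: "a \<cdot>\<^sub>v (A *\<^sub>v v) + b \<cdot>\<^sub>v (B *\<^sub>v v) = 0\<^sub>v n" by blast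
  have "(\<Sum>j<n. (a * M i j + b * M' i j) * v $ j) = 0" if "i < n" for i
  proof -
    have "0 = (a \<cdot>\<^sub>v (A *\<^sub>v v) + b \<cdot>\<^sub>v (B *\<^sub>v v)) $ i" using eq that by simp
    also have "\<dots> = a * (\<Sum>j<n. M i j * v $ j) + b * (\<Sum>j<n. M' i j * v $ j)"
      using that v by (simp add: A_def B_def scalar_prod_def atLeast0LessThan)
    finally show ?thesis by (simp add: sum_distrib_left sum.distrib algebra_simps)
  qed
  moreover have "\<exists>j<n. v $ j \<noteq> 0" using v by (metis eq_vecI index_zero_vec carrier_vecD)
  ultimately show ?thesis using ab by (intro exI[of _ a] exI[of _ b] exI[of _ "($) v"]) auto
qed

context vector_space
begin

text \<open>By Steinitz exchange, dropping \<open>R\<close> from a spanning set loses at most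
  \<open>card R\<close> dimensions. This bounds the loss when vectors are projected along
  \<open>R\<close>.\<close>

lemma independent_subset_exchange:
  assumes S: "independent S" and fin: "finite T" "finite R" and sub: "S \<subseteq> span (T \<union> R)"
  obtains B where "B \<subseteq> T" "independent B" "card S \<le> card B + card R"
proof -
  obtain B where B: "B \<subseteq> T" "independent B" "T \<subseteq> span B"
    by (rule maximal_independent_subset)
  have "T \<union> R \<subseteq> span (B \<union> R)" using B(3) span_mono[of B "B \<union> R"] span_superset by blast
  then have "span (T \<union> R) \<subseteq> span (B \<union> R)" by (rule span_minimal) (rule subspace_span)
  then have "card S \<le> card (B \<union> R)"
    using independent_span_bound[of "B \<union> R" S] S sub fin finite_subset[OF B(1)] by auto
  then show ?thesis using that[OF B(1,2)] card_Un_le[of B R] by linarith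
qed

lemma independent_Un:
  assumes S: "independent S" "finite S" and T: "independent T" "finite T"
    and int: "span S \<inter> span T \<subseteq> {0}"
  shows "independent (S \<union> T)" "S \<inter> T = {}"
proof -
  show disj: "S \<inter> T = {}"
  proof (rule ccontr)
    assume "S \<inter> T \<noteq> {}"
    then obtain x where "x \<in> S" "x \<in> T" by blast
    then have "x = 0" using int span_base by blast
    then show False using \<open>x \<in> S\<close> S dependent_zero by blast
  qed
  show "independent (S \<union> T)"
  proof (rule independent_if_scalars_zero)
    fix g x assume sum: "(\<Sum>x\<in>S \<union> T. g x *s x) = 0" and x: "x \<in> S \<union> T"
    define p q where "p = (\<Sum>x\<in>S. g x *s x)" and "q = (\<Sum>x\<in>T. g x *s x)"
    have pq: "p + q = 0" using sum S T disj by (simp add: p_def q_def sum.union_disjoint)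
    have "p \<in> span S" "q \<in> span T" unfolding p_def q_def by (auto intro: span_sum span_scale[OF span_base])
    moreover have "p = - q" using pq by (simp add: eq_neg_iff_add_eq_0)
    ultimately have "p \<in> span S \<inter> span T" by (simp add: span_neg)
    then have "p = 0" "q = 0" using int pq by auto
    then show "g x = 0"
      using x independentD[OF S subset_refl, of g x] independentD[OF T subset_refl, of g x]
      unfolding p_def q_def by blast
  qed (use S T in auto)
qed

lemma span_Int_span_Diff:
  assumes X: "independent X" "finite X" and J: "J \<subseteq> X"
  shows "span J \<inter> span (X - J) \<subseteq> {0}"
proof
  fix y assume y: "y \<in> span J \<inter> span (X - J)"
  have fin: "finite J" "finite (X - J)" using X J finite_subset by auto
  obtain g where g: "y = (\<Sum>x\<in>J. g x *s x)" using y span_finite[OF fin(1)] by auto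
  obtain h where h: "y = (\<Sum>x\<in>X - J. h x *s x)" using y span_finite[OF fin(2)] by auto
  have "X = J \<union> (X - J)" using J by auto
  then have "(\<Sum>x\<in>X. (if x \<in> J then g x else - h x) *s x) =
      (\<Sum>x\<in>J. (if x \<in> J then g x else - h x) *s x) + (\<Sum>x\<in>X - J. (if x \<in> J then g x else - h x) *s x)"
    using sum.union_disjoint[OF fin Diff_disjoint, of "\<lambda>x. (if x \<in> J then g x else - h x) *s x"]
    by (simp only:)
  also have "\<dots> = y + - y"
    by (subst (1) g, subst h) (simp add: sum_negf[symmetric])
  finally have "(\<Sum>x\<in>X. (if x \<in> J then g x else - h x) *s x) = 0" by simp
  then have "g x = 0" if "x \<in> J" for x
    using independentD[OF X subset_refl, of "\<lambda>x. if x \<in> J then g x else - h x" x] that J by auto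
  then show "y \<in> {0}" using g by simp
qed

text \<open>Dimension is measured by cardinalities of sets, while vectors are constructed as indexed
  families; a repeated vector would give a relation with coefficients \<open>1\<close> and
  \<open>- 1\<close>.\<close>

lemma independent_family:
  assumes I: "finite I" and z: "\<And>g i. (\<Sum>i\<in>I. g i *s v i) = 0 \<Longrightarrow> i \<in> I \<Longrightarrow> g i = 0"
  shows "inj_on v I" "independent (v ` I)"
proof -
  show inj: "inj_on v I"
  proof (rule inj_onI, rule ccontr)
    fix i j assume ij: "i \<in> I" "j \<in> I" "v i = v j" "i \<noteq> j"
    define g :: "'c \<Rightarrow> 'a" where "g l = (if l = i then 1 else if l = j then - 1 else 0)" for l
    have "(\<Sum>l\<in>I. g l *s v l) = (\<Sum>l\<in>{i, j}. g l *s v l)"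
      using I ij by (intro sum.mono_neutral_right) (auto simp: g_def)
    also have "\<dots> = 0" using ij by (simp add: g_def)
    finally have "g i = 0" using z ij by blast
    then show False by (simp add: g_def)
  qed
  show "independent (v ` I)"
  proof (rule independent_if_scalars_zero)
    fix g x assume sum: "(\<Sum>x\<in>v ` I. g x *s x) = 0" and x: "x \<in> v ` I"
    have "(\<Sum>i\<in>I. g (v i) *s v i) = 0" using sum by (simp add: sum.reindex[OF inj])
    then show "g x = 0" using z[of "\<lambda>i. g (v i)"] x by auto
  qed (use I in auto)
qed

text \<open>Subtracting multiples of one vector \<open>s0\<close> outside the kernel moves the
  others into it. Together with \<open>s0\<close> they still span \<open>S\<close>, so only one
  dimension is lost.\<close>

lemma independent_in_kernel:
  assumes S: "independent S" "finite S"
    and add: "\<And>x y. \<phi> (x + y) = \<phi> x + \<phi> y" and scale: "\<And>c x. \<phi> (c *s x) = c * \<phi> x"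
  obtains T where "T \<subseteq> span S" "finite T" "independent T" "\<And>y. y \<in> T \<Longrightarrow> \<phi> y = 0" "card S \<le> card T + 1"
proof (cases "\<forall>s\<in>S. \<phi> s = 0")
  case True
  then show ?thesis using that[of S] S span_superset by auto
next
  case False
  then obtain s0 where s0: "s0 \<in> S" "\<phi> s0 \<noteq> 0" by auto
  define p where "p s = s - (\<phi> s / \<phi> s0) *s s0" for s
  have diff: "\<phi> (x - y) = \<phi> x - \<phi> y" for x y using add[of "x - y" y] by simp
  have sp: "s \<in> span (p ` S \<union> {s0})" if "s \<in> S" for s
  proof -
    have "p s + (\<phi> s / \<phi> s0) *s s0 \<in> span (p ` S \<union> {s0})"
      using that by (intro span_add span_scale span_base) auto
    then show ?thesis by (simp add: p_def)
  qed
  obtain B where B: "B \<subseteq> p ` S" "independent B" "card S \<le> card B + card {s0}"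
    using independent_subset_exchange[OF S(1), of "p ` S" "{s0}"] sp S by blast
  have "p ` S \<subseteq> span S" using s0 by (auto simp: p_def intro: span_diff[OF span_base span_scale[OF span_base]])
  moreover have "\<phi> (p s) = 0" for s using s0 by (simp add: p_def diff scale)
  moreover have "finite B" using finite_subset[OF B(1)] S by auto
  ultimately show ?thesis by (intro that[of B]) (use B in auto)
qed

end

section \<open>Isotropic subspaces of sesquilinear forms\<close>

locale sesquilinear_space = vector_space scale
  for scale :: "complex \<Rightarrow> 'v::ab_group_add \<Rightarrow> 'v" (infixr \<open>*s\<close> 75) +
  fixes f :: "'v \<Rightarrow> 'v \<Rightarrow> complex"
  assumes add_left: "f (x + y) z = f x z + f y z"
    and add_right: "f x (y + z) = f x y + f x z"
    and scale_left: "f (c *s x) y = cnj c * f x y"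
    and scale_right: "f x (c *s y) = c * f x y"
begin

lemma zero_left [simp]: "f 0 y = 0" using add_left[of 0 0 y] by simp
lemma zero_right [simp]: "f x 0 = 0" using add_right[of x 0 0] by simp
lemma diff_left: "f (x - y) z = f x z - f y z" using add_left[of "x - y" y z] by simp
lemma diff_right: "f x (y - z) = f x y - f x z" using add_right[of x "y - z" z] by simp
lemma sum_left: "f (\<Sum>i\<in>A. g i) y = (\<Sum>i\<in>A. f (g i) y)"
  by (induction A rule: infinite_finite_induct) (auto simp: add_left)
lemma sum_right: "f x (\<Sum>i\<in>A. g i) = (\<Sum>i\<in>A. f x (g i))"
  by (induction A rule: infinite_finite_induct) (auto simp: add_right)

lemma orthogonal_sum:
  assumes "finite A" "\<And>x y. x \<in> A \<Longrightarrow> y \<in> A \<Longrightarrow> x \<noteq> y \<Longrightarrow> f x y = 0"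
  shows "f (\<Sum>x\<in>A. g x *s x) (\<Sum>x\<in>A. h x *s x) = (\<Sum>x\<in>A. cnj (g x) * h x * f x x)"
proof -
  have "f (\<Sum>x\<in>A. g x *s x) (\<Sum>x\<in>A. h x *s x) = (\<Sum>x\<in>A. \<Sum>y\<in>A. cnj (g x) * (h y * f x y))"
    unfolding sum_left scale_left unfolding sum_right scale_right sum_distrib_left ..
  also have "\<dots> = (\<Sum>x\<in>A. \<Sum>y\<in>A. if y = x then cnj (g x) * h x * f x x else 0)"
    using assms(2) by (intro sum.cong) auto
  finally show ?thesis using assms(1) by simp
qed

lemma subspace_left_kernel: "subspace {y. f y x = 0}"
  by (rule subspaceI) (auto simp: add_left scale_left)

lemma subspace_right_kernel: "subspace {y. f x y = 0}"
  by (rule subspaceI) (auto simp: add_right scale_right)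

lemma span_orthogonal:
  assumes A: "\<And>x y. x \<in> A \<Longrightarrow> y \<in> B \<Longrightarrow> f x y = 0" and xy: "x \<in> span A" "y \<in> span B"
  shows "f x y = 0"
proof -
  have "f x y = 0" if "y \<in> B" for y
    using span_minimal[OF _ subspace_left_kernel, of A y] A that xy by blast
  then show ?thesis using span_minimal[OF _ subspace_right_kernel, of B x] xy by blast
qed

text \<open>Orthogonality is required on both sides, since \<open>f\<close> need not be
  hermitian.\<close>

definition perp :: "'v set \<Rightarrow> 'v \<Rightarrow> 'v set" where
  "perp U x = {y\<in>U. f x y = 0 \<and> f y x = 0}"

lemma subspace_perp: "subspace U \<Longrightarrow> subspace (perp U x)"
proof -
  have "perp U x = U \<inter> ({y. f y x = 0} \<inter> {y. f x y = 0})" by (auto simp: perp_def)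
  then show "subspace U \<Longrightarrow> subspace (perp U x)"
    by (simp add: subspace_inter subspace_left_kernel subspace_right_kernel)
qed

text \<open>The pencil spanned by the form and its adjoint is singular at \<^term>\<open>x\<close>; then the two
  functionals \<^term>\<open>f x\<close> and \<^term>\<open>\<lambda>y. cnj (f y x)\<close> are linearly dependent, so
  \<^term>\<open>perp U x\<close> has codimension at most one.\<close>
definition pencil_eigenvector :: "'v set \<Rightarrow> 'v \<Rightarrow> complex \<Rightarrow> complex \<Rightarrow> bool" where
  "pencil_eigenvector U x a b \<longleftrightarrow> x \<in> U \<and> x \<noteq> 0 \<and> (a \<noteq> 0 \<or> b \<noteq> 0) \<and>
     (\<forall>y\<in>U. a * f y x + b * cnj (f x y) = 0)"

lemma subspace_pencil: "subspace {y. a * f y x + b * cnj (f x y) = 0}"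
proof (rule subspaceI)
  fix c y assume "y \<in> {y. a * f y x + b * cnj (f x y) = 0}"
  then have "cnj c * (a * f y x + b * cnj (f x y)) = 0" by simp
  then show "c *s y \<in> {y. a * f y x + b * cnj (f x y) = 0}"
    by (simp add: scale_left scale_right algebra_simps)
next
  fix y z assume "y \<in> {y. a * f y x + b * cnj (f x y) = 0}" "z \<in> {y. a * f y x + b * cnj (f x y) = 0}"
  then have "(a * f y x + b * cnj (f x y)) + (a * f z x + b * cnj (f x z)) = 0" by simp
  then show "y + z \<in> {y. a * f y x + b * cnj (f x y) = 0}"
    by (simp add: add_left add_right algebra_simps)
qed simp

text \<open>In a basis of \<open>U\<close> the pencil is spanned by the Gram matrix of
  \<open>f\<close> and its conjugate transpose; a null vector of a singular combination gives the
  coordinates of \<open>x\<close>.\<close>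

lemma ex_pencil_eigenvector:
  assumes U: "subspace U" "U \<subseteq> span B" "finite B" and nz: "U \<noteq> {0}"
  shows "\<exists>x a b. pencil_eigenvector U x a b"
proof -
  obtain C where C: "C \<subseteq> U" "independent C" "U \<subseteq> span C"
    by (rule maximal_independent_subset)
  have finC: "finite C" using independent_span_bound[of B C] U C by auto
  have "C \<noteq> {}" using C nz subspace_0[OF U(1)] by auto
  then have n: "card C > 0" using finC by (simp add: card_gt_0_iff)
  obtain h where h: "bij_betw h {..<card C} C"
    using finC ex_bij_betw_nat_finite[OF finC] by (auto simp: atLeast0LessThan)
  obtain a b c where ab: "a \<noteq> 0 \<or> b \<noteq> 0" and c: "\<exists>j<card C. c j \<noteq> 0"
    and eq: "\<forall>i<card C. (\<Sum>j<card C. (a * f (h i) (h j) + b * cnj (f (h j) (h i))) * c j) = 0"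
    using ex_singular_combination[OF n, of "\<lambda>i j. f (h i) (h j)" "\<lambda>i j. cnj (f (h j) (h i))"] by blast
  define x where "x = (\<Sum>j<card C. c j *s h j)"
  have hC: "h j \<in> C" if "j < card C" for j using h that by (auto simp: bij_betw_def)
  have "x \<in> U" unfolding x_def
    using C(1) hC by (intro subspace_sum[OF U(1)] subspace_scale[OF U(1)]) auto
  moreover have "x \<noteq> 0"
  proof
    assume "x = 0"
    have inv: "inv_into {..<card C} h (h j) = j" if "j < card C" for j
      using h that by (auto simp: bij_betw_def)
    have "(\<Sum>y\<in>C. c (inv_into {..<card C} h y) *s y) = (\<Sum>j<card C. c (inv_into {..<card C} h (h j)) *s h j)"
      by (rule sum.reindex_bij_betw[OF h, symmetric])
    also have "\<dots> = x" unfolding x_def using inv by (intro sum.cong) auto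
    finally have "c (inv_into {..<card C} h y) = 0" if "y \<in> C" for y
      using independentD[OF C(2) finC subset_refl, of "\<lambda>y. c (inv_into {..<card C} h y)" y] that \<open>x = 0\<close> by simp
    then have "c j = 0" if "j < card C" for j using inv[OF that] hC[OF that] by metis
    then show False using c by auto
  qed
  moreover have "a * f y x + b * cnj (f x y) = 0" if "y \<in> C" for y
  proof -
    obtain i where i: "i < card C" "y = h i" using h \<open>y \<in> C\<close> by (auto simp: bij_betw_def)
    have "a * f y x + b * cnj (f x y) = (\<Sum>j<card C. (a * f (h i) (h j) + b * cnj (f (h j) (h i))) * c j)"
      by (simp add: x_def i sum_left sum_right scale_left scale_right sum_distrib_left sum.distrib algebra_simps)
    then show ?thesis using eq i by simp
  qed
  then have "span C \<subseteq> {y. a * f y x + b * cnj (f x y) = 0}"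
    by (intro span_minimal subspace_pencil) auto
  ultimately show ?thesis using ab C(3) unfolding pencil_eigenvector_def by blast
qed

text \<open>A pencil eigenvector \<open>x\<close> splits off: it is not isotropic, and in
  \<open>U\<close> orthogonality to it on one side implies the other, so \<open>perp U x\<close> is
  a complement of its line. The induction runs on the size of a spanning set.\<close>

lemma orthogonal_basis:
  assumes "subspace U" "U \<subseteq> span B" "finite B"
    and "\<And>x a b. pencil_eigenvector U x a b \<Longrightarrow> f x x \<noteq> 0"
  shows "\<exists>X. finite X \<and> independent X \<and> X \<subseteq> U \<and> span X = U \<and>
    (\<forall>x\<in>X. f x x \<noteq> 0) \<and> (\<forall>x\<in>X. \<forall>y\<in>X. x \<noteq> y \<longrightarrow> f x y = 0)"
  using assms
proof (induction "card B" arbitrary: U B rule: less_induct)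
  case less
  show ?case
  proof (cases "U = {0}")
    case True
    then show ?thesis by (intro exI[of _ "{}"]) (auto simp: independent_empty)
  next
    case False
    obtain x a b where x: "pencil_eigenvector U x a b"
      using ex_pencil_eigenvector[OF less.prems(1-3) False] by blast
    have fx: "f x x \<noteq> 0" using less.prems(4)[OF x] .
    have xU: "x \<in> U" and rel: "\<And>y. y \<in> U \<Longrightarrow> a * f y x + b * cnj (f x y) = 0" and ab: "a \<noteq> 0 \<or> b \<noteq> 0"
      using x by (auto simp: pencil_eigenvector_def)
    \<comment> \<open>With \<open>a = 0\<close> the relation at \<open>y = x\<close> would force
      \<open>b = 0\<close>.\<close>
    have a: "a \<noteq> 0" using rel[OF xU] ab fx by auto
    define W where "W = perp U x"
    have W: "subspace W" "W \<subseteq> U" using subspace_perp[OF less.prems(1)] by (auto simp: W_def perp_def)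
    obtain C where C: "C \<subseteq> W" "independent C" "W \<subseteq> span C"
      by (rule maximal_independent_subset)
    have spC: "span C \<subseteq> W" using C W by (intro span_minimal)
    have xW: "x \<notin> W" using fx by (auto simp: W_def perp_def)
    have "independent (insert x C)" using xW spC C(2) by (intro independent_insertI) auto
    moreover have "insert x C \<subseteq> span B" using C(1) W(2) xU less.prems(2) by auto
    ultimately have "finite (insert x C) \<and> card (insert x C) \<le> card B"
      by (rule independent_span_bound[OF less.prems(3)])
    moreover have "x \<notin> C" using xW C by auto
    ultimately have finC: "finite C" and cC: "card C < card B" by auto
    \<comment> \<open>Each \<open>z\<close> in \<open>U\<close> differs from a member of
      \<open>W\<close> by a multiple of \<open>x\<close>, to which \<open>y\<close> is orthogonal.
      Thus \<open>W\<close> inherits the hypothesis on eigenvectors.\<close>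
    have "pencil_eigenvector U y a' b'" if y: "pencil_eigenvector W y a' b'" for y a' b'
      unfolding pencil_eigenvector_def
    proof (intro conjI ballI)
      show "y \<in> U" "y \<noteq> 0" "a' \<noteq> 0 \<or> b' \<noteq> 0" using y W by (auto simp: pencil_eigenvector_def)
      fix z assume z: "z \<in> U"
      define t where "t = f x z / f x x"
      have yW: "f x y = 0" "f y x = 0" using y by (auto simp: pencil_eigenvector_def W_def perp_def)
      have zU: "z - t *s x \<in> U" using z xU less.prems(1) by (intro subspace_diff subspace_scale)
      have "f x (z - t *s x) = 0" using fx by (simp add: diff_right scale_right t_def)
      then have "z - t *s x \<in> W" using rel[OF zU] a zU by (simp add: W_def perp_def)
      then have "a' * f (z - t *s x) y + b' * cnj (f y (z - t *s x)) = 0"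
        using y by (auto simp: pencil_eigenvector_def)
      then show "a' * f z y + b' * cnj (f y z) = 0"
        using yW by (simp add: diff_left diff_right scale_left scale_right)
    qed
    then have noniso: "\<And>y a' b'. pencil_eigenvector W y a' b' \<Longrightarrow> f y y \<noteq> 0"
      using less.prems(4) by blast
    have "\<exists>X. finite X \<and> independent X \<and> X \<subseteq> W \<and> span X = W \<and>
      (\<forall>x\<in>X. f x x \<noteq> 0) \<and> (\<forall>x\<in>X. \<forall>y\<in>X. x \<noteq> y \<longrightarrow> f x y = 0)"
      by (rule less.hyps[OF cC W(1) C(3) finC]) (rule noniso)
    then obtain X where X: "finite X" "independent X" "X \<subseteq> W" "span X = W"
      "\<forall>x\<in>X. f x x \<noteq> 0" "\<forall>x\<in>X. \<forall>y\<in>X. x \<noteq> y \<longrightarrow> f x y = 0"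
      by (elim exE conjE)
    have "U \<subseteq> span (insert x X)"
    proof
      fix z assume z: "z \<in> U"
      define t where "t = f x z / f x x"
      have zU: "z - t *s x \<in> U" using z xU less.prems(1) by (intro subspace_diff subspace_scale)
      have "f x (z - t *s x) = 0" using fx by (simp add: diff_right scale_right t_def)
      then have "z - t *s x \<in> W" using rel[OF zU] a zU by (simp add: W_def perp_def)
      then show "z \<in> span (insert x X)" unfolding span_insert using X(4) by auto
    qed
    moreover have "span (insert x X) \<subseteq> U"
      using xU X(3) W(2) less.prems(1) by (intro span_minimal) auto
    moreover have "independent (insert x X)" using xW X by (intro independent_insertI) auto
    moreover have "f x y = 0" "f y x = 0" if "y \<in> X" for y
      using X(3) that by (auto simp: W_def perp_def)
    ultimately show ?thesis
      using X xU W(2) fx by (intro exI[of _ "insert x X"]) auto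
  qed
qed

section \<open>Nonnegative and isotropic subspaces\<close>

text \<open>Matrices will supply subspaces on which the hermitian form vanishes. Nonnegativity is
  what the induction can reproduce: for a diagonal form and generic \<open>z\<close> it amounts to
  counting basis vectors of positive value.\<close>

definition nonneg_on :: "'v set \<Rightarrow> nat \<Rightarrow> complex \<Rightarrow> bool" where
  "nonneg_on U k z \<longleftrightarrow> (\<exists>S\<subseteq>U. finite S \<and> independent S \<and> card S = k \<and>
     (\<forall>y\<in>span S. 0 \<le> Re (cnj z * f y y)))"

definition isotropic_on :: "'v set \<Rightarrow> nat \<Rightarrow> bool" where
  "isotropic_on U k \<longleftrightarrow> (\<exists>S\<subseteq>U. finite S \<and> independent S \<and> card S = k \<and>
     (\<forall>x\<in>S. \<forall>y\<in>S. f x y = 0))"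

lemma nonneg_on_antimono:
  assumes "finite S" "independent S" "S \<subseteq> U" "k \<le> card S" "\<And>y. y \<in> span S \<Longrightarrow> 0 \<le> Re (cnj z * f y y)"
  shows "nonneg_on U k z"
proof -
  obtain T where T: "T \<subseteq> S" "card T = k" using obtain_subset_with_card_n[OF assms(4)] by metis
  then show ?thesis unfolding nonneg_on_def
    using assms independent_mono[OF assms(2) T(1)] span_mono[OF T(1)] finite_subset[OF T(1)]
    by (intro exI[of _ T]) auto
qed

lemma isotropic_on_antimono:
  assumes "finite S" "independent S" "S \<subseteq> U" "k \<le> card S" "\<And>x y. x \<in> S \<Longrightarrow> y \<in> S \<Longrightarrow> f x y = 0"
  shows "isotropic_on U k"
proof -
  obtain T where T: "T \<subseteq> S" "card T = k" using obtain_subset_with_card_n[OF assms(4)] by metis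
  have "f x y = 0" if "x \<in> T" "y \<in> T" for x y using assms(5)[of x y] T(1) that by auto
  then show ?thesis unfolding isotropic_on_def
    using assms(1-4) T independent_mono[OF assms(2) T(1)] finite_subset[OF T(1)]
    by (intro exI[of _ T]) auto
qed

text \<open>As for semidefinite forms, an isotropic vector lies in the radical: otherwise adding a
  suitable multiple of \<open>x\<close> to \<open>y\<close> would make the value negative.\<close>

lemma isotropic_vector_orthogonal:
  assumes S: "subspace S" "x \<in> S" "y \<in> S" and nn: "\<And>y. y \<in> S \<Longrightarrow> 0 \<le> Re (cnj z * f y y)"
    and iso: "f x x = 0"
  shows "cnj z * f x y + z * cnj (f y x) = 0"
proof (rule ccontr)
  define h where "h = cnj z * f x y + z * cnj (f y x)"
  assume "cnj z * f x y + z * cnj (f y x) \<noteq> 0"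
  then have h: "(cmod h)\<^sup>2 > 0" by (simp add: h_def)
  define a where "a = Re (cnj z * f y y)"
  \<comment> \<open>Chosen so that the value at \<open>y + t *s x\<close> is exactly
    \<open>- 1\<close>.\<close>
  define r where "r = (a + 1) / (cmod h)\<^sup>2"
  define t where "t = - of_real r * h"
  have "y + t *s x \<in> S" using S by (intro subspace_add subspace_scale)
  from nn[OF this] have "0 \<le> Re (cnj z * (f y y + t * f y x + cnj t * f x y))"
    by (simp add: add_left add_right scale_left scale_right iso algebra_simps)
  also have "\<dots> = a + Re (cnj t * h)"
    by (simp add: a_def h_def algebra_simps)
  also have "cnj t * h = of_real (- r * (cmod h)\<^sup>2)"
    unfolding t_def by (simp add: complex_norm_square mult.commute del: of_real_power)
  also have "a + Re (of_real (- r * (cmod h)\<^sup>2)) = - 1"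
    using h by (simp add: r_def)
  finally show False by simp
qed

text \<open>Orthogonality with respect to the hermitian part in direction \<open>z\<close> and the pencil relation are
  two linear equations for \<open>f x y\<close> and \<open>cnj (f y x)\<close>. Their determinant vanishes on at most one real
  line of directions \<open>z\<close>, the line perpendicular to \<open>d\<close>.\<close>
lemma pencil_exceptional_line:
  assumes "pencil_eigenvector U x a b"
  obtains d where "d \<noteq> 0" "\<And>z y. Re (cnj z * d) \<noteq> 0 \<Longrightarrow> y \<in> U \<Longrightarrow>
    cnj z * f x y + z * cnj (f y x) = 0 \<Longrightarrow> f x y = 0 \<and> f y x = 0"
proof
  have ab: "a \<noteq> 0 \<or> b \<noteq> 0" and rel: "\<And>y. y \<in> U \<Longrightarrow> a * f y x + b * cnj (f x y) = 0"
    using assms by (auto simp: pencil_eigenvector_def)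
  \<comment> \<open>A vanishing determinant makes \<open>z\<close> perpendicular to both
    \<open>cnj a - b\<close> and \<open>\<i> * (cnj a + b)\<close>. These are not both zero, and
    \<open>d\<close> is a nonzero one.\<close>
  define d where "d = (if cnj a = b then \<i> * (cnj a + b) else cnj a - b)"
  show "d \<noteq> 0" using ab by (auto simp: d_def)
  fix z y assume z: "Re (cnj z * d) \<noteq> 0" and y: "y \<in> U"
    and h: "cnj z * f x y + z * cnj (f y x) = 0"
  have ne: "cnj z * cnj a - z * cnj b \<noteq> 0"
  proof
    assume "cnj z * cnj a - z * cnj b = 0"
    then have eq: "cnj z * cnj a = cnj (cnj z * b)" by simp
    then have "Re (cnj z * (cnj a - b)) = 0" "Re (cnj z * (\<i> * (cnj a + b))) = 0"
      using arg_cong[OF eq, of Re] arg_cong[OF eq, of Im] by (simp_all add: algebra_simps)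
    then have "Re (cnj z * d) = 0" by (simp only: d_def split: if_splits) simp
    then show False using z by simp
  qed
  have rel': "cnj a * cnj (f y x) + cnj b * f x y = 0"
    using arg_cong[OF rel[OF y], of cnj] by simp
  have "(cnj z * cnj a - z * cnj b) * f x y
      = cnj a * (cnj z * f x y + z * cnj (f y x)) - z * (cnj a * cnj (f y x) + cnj b * f x y)"
    by (simp add: algebra_simps)
  then have "f x y = 0" using h rel' ne by simp
  moreover have "(cnj z * cnj a - z * cnj b) * cnj (f y x)
      = cnj z * (cnj a * cnj (f y x) + cnj b * f x y) - cnj b * (cnj z * f x y + z * cnj (f y x))"
    by (simp add: algebra_simps)
  then have "f y x = 0" using h rel' ne by simp
  ultimately show "f x y = 0 \<and> f y x = 0" by simp
qed

text \<open>One functional decides: if \<open>a = 0\<close>, then \<open>f x\<close> vanishes on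
  \<open>U\<close>, and \<open>f y x\<close> is conjugated to become linear; otherwise
  \<open>f x y = 0\<close> implies \<open>f y x = 0\<close>.\<close>

lemma perp_kernel:
  assumes "pencil_eigenvector U x a b"
  obtains \<phi> where "\<And>y z. \<phi> (y + z) = \<phi> y + \<phi> z" "\<And>c y. \<phi> (c *s y) = c * \<phi> y"
    "\<And>y. y \<in> U \<Longrightarrow> \<phi> y = 0 \<Longrightarrow> y \<in> perp U x"
proof (cases "a = 0")
  case True
  show ?thesis
  proof (rule that[of "\<lambda>y. cnj (f y x)"])
    fix y assume "y \<in> U" "cnj (f y x) = 0"
    then show "y \<in> perp U x" using assms True by (auto simp: perp_def pencil_eigenvector_def)
  qed (auto simp: add_left scale_left)
next
  case False
  show ?thesis
  proof (rule that[of "f x"])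
    fix y assume "y \<in> U" "f x y = 0"
    moreover from this have "a * f y x = 0"
      using assms unfolding pencil_eigenvector_def by force
    ultimately show "y \<in> perp U x" using False by (auto simp: perp_def)
  qed (auto simp: add_right scale_right)
qed

text \<open>If \<open>x\<close> lies in the nonnegative subspace, it is orthogonal to all of it by
  \<open>isotropic_vector_orthogonal\<close> and \<open>exc\<close>. If not, cutting with the kernel
  of \<open>\<phi>\<close> loses at most one dimension and adjoining \<open>x\<close> regains it. In
  both cases the result lies in \<open>perp U x\<close> and contains \<open>x\<close>; passing to it
  modulo \<open>x\<close> costs one dimension.\<close>

lemma nonneg_on_reduce:
  assumes U: "subspace U" and x: "x \<in> U" "f x x = 0"
    and ker: "\<And>y z. \<phi> (y + z) = \<phi> y + \<phi> z" "\<And>c y. \<phi> (c *s y) = c * \<phi> y"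
      "\<And>y. y \<in> U \<Longrightarrow> \<phi> y = 0 \<Longrightarrow> y \<in> perp U x"
    and exc: "\<And>y. y \<in> U \<Longrightarrow> cnj z * f x y + z * cnj (f y x) = 0 \<Longrightarrow> f x y = 0 \<and> f y x = 0"
    and C: "perp U x \<subseteq> span (insert x C)"
    and nn: "nonneg_on U (Suc k) z"
  shows "nonneg_on (span C) k z"
proof -
  define W where "W = perp U x"
  have W: "subspace W" "W \<subseteq> U" using subspace_perp[OF U] by (auto simp: W_def perp_def)
  have xW: "x \<in> W" using x by (auto simp: W_def perp_def)
  obtain S where S: "S \<subseteq> U" "finite S" "independent S" "card S = Suc k"
    "\<And>y. y \<in> span S \<Longrightarrow> 0 \<le> Re (cnj z * f y y)"
    using nn by (auto simp: nonneg_on_def)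
  have SU: "span S \<subseteq> U" using S(1) U by (intro span_minimal)
  obtain T where T: "T \<subseteq> W" "finite T" "independent T" "Suc k \<le> card T" "x \<in> span T"
    "\<And>y. y \<in> span T \<Longrightarrow> 0 \<le> Re (cnj z * f y y)"
  proof (cases "x \<in> span S")
    case True
    have "S \<subseteq> W"
    proof
      fix s assume s: "s \<in> S"
      have "cnj z * f x s + z * cnj (f s x) = 0"
        by (rule isotropic_vector_orthogonal[of "span S"]) (use True s S(5) x in \<open>auto intro: span_base\<close>)
      then show "s \<in> W" using exc[of s] s S(1) by (auto simp: W_def perp_def)
    qed
    then show ?thesis using that[of S] S True by auto
  next
    case False
    obtain R where R: "R \<subseteq> span S" "finite R" "independent R" "\<And>y. y \<in> R \<Longrightarrow> \<phi> y = 0" "card S \<le> card R + 1"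
      using independent_in_kernel[OF S(3,2), of \<phi>] ker(1,2) by blast
    have RW: "R \<subseteq> W" using R SU ker(3) by (auto simp: W_def)
    have spR: "span R \<subseteq> span S" using R(1) by (intro span_minimal subspace_span)
    have xR: "x \<notin> span R" using False spR by auto
    then have xR': "x \<notin> R" using span_base by blast
    show ?thesis
    proof (rule that[of "insert x R"])
      show "insert x R \<subseteq> W" using RW xW by simp
      show "independent (insert x R)" using xR R(3) by (rule independent_insertI)
      show "Suc k \<le> card (insert x R)" using R xR' S(4) by simp
      fix y assume "y \<in> span (insert x R)"
      then obtain c where c: "y - c *s x \<in> span R" by (auto simp: span_insert)
      define v where "v = y - c *s x"
      have "v \<in> W" using c RW W(1) span_minimal[of R W] by (auto simp: v_def)
      then have "f (v + c *s x) (v + c *s x) = f v v"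
        using x(2) by (simp add: add_left add_right scale_left scale_right W_def perp_def)
      then have "f y y = f v v" by (simp add: v_def)
      then show "0 \<le> Re (cnj z * f y y)" using S(5)[of v] c spR by (auto simp: v_def)
    qed (use R in \<open>auto intro: span_base\<close>)
  qed
  have "\<exists>c. s - c *s x \<in> span C" if "s \<in> T" for s
    using T(1) C that by (auto simp: W_def span_insert)
  then obtain c where c: "\<And>s. s \<in> T \<Longrightarrow> s - c s *s x \<in> span C" by metis
  \<comment> \<open>Representatives modulo \<open>x\<close> inside \<open>span C\<close>. They stay
    in \<open>span T\<close>, which contains \<open>x\<close>, so nonnegativity is kept.\<close>
  define p where "p s = s - c s *s x" for s
  have "T \<subseteq> span (p ` T \<union> {x})"
  proof
    fix s assume "s \<in> T"
    then have "p s + c s *s x \<in> span (p ` T \<union> {x})" by (intro span_add span_scale span_base) auto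
    then show "s \<in> span (p ` T \<union> {x})" by (simp add: p_def)
  qed
  then obtain B where B: "B \<subseteq> p ` T" "independent B" "card T \<le> card B + card {x}"
    using independent_subset_exchange[OF T(3), of "p ` T" "{x}"] T(2) by blast
  have "p ` T \<subseteq> span T" using T(5) by (auto simp: p_def intro: span_diff[OF span_base span_scale])
  then have "span B \<subseteq> span T" using B(1) by (intro span_minimal subspace_span) auto
  then show ?thesis
    using B T c finite_subset[OF B(1)] by (intro nonneg_on_antimono[of B]) (auto simp: p_def)
qed

text \<open>The argument of Sylvester's law of inertia: the form is negative definite on the span of
  the vectors of negative value, which therefore meets the nonnegative subspace only in
  \<open>0\<close>.\<close>

lemma card_pos_of_nonneg_on:
  assumes X: "finite X" "independent X" and orth: "\<And>x y. x \<in> X \<Longrightarrow> y \<in> X \<Longrightarrow> x \<noteq> y \<Longrightarrow> f x y = 0"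
    and nz: "\<And>x. x \<in> X \<Longrightarrow> Re (cnj z * f x x) \<noteq> 0" and nn: "nonneg_on (span X) k z"
  shows "k \<le> card {x\<in>X. Re (cnj z * f x x) > 0}"
proof -
  obtain S where S: "S \<subseteq> span X" "finite S" "independent S" "card S = k"
    "\<And>y. y \<in> span S \<Longrightarrow> 0 \<le> Re (cnj z * f y y)"
    using nn by (auto simp: nonneg_on_def)
  define P N where "P = {x\<in>X. Re (cnj z * f x x) > 0}" and "N = {x\<in>X. Re (cnj z * f x x) < 0}"
  have N: "finite N" "independent N" using X independent_mono[of X N] by (auto simp: N_def)
  have "span S \<inter> span N \<subseteq> {0}"
  proof
    fix y assume y: "y \<in> span S \<inter> span N"
    then obtain g where g: "y = (\<Sum>x\<in>N. g x *s x)" using span_finite[OF N(1)] by auto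
    have "f y y = (\<Sum>x\<in>N. cnj (g x) * g x * f x x)"
      unfolding g by (rule orthogonal_sum[OF N(1)]) (auto simp: N_def orth)
    then have "Re (cnj z * f y y) = (\<Sum>x\<in>N. Re (cnj z * (cnj (g x) * g x * f x x)))"
      by (simp only: sum_distrib_left Re_sum)
    also have "\<dots> = (\<Sum>x\<in>N. (cmod (g x))\<^sup>2 * Re (cnj z * f x x))"
    proof (rule sum.cong)
      fix x
      have "cnj z * (cnj (g x) * g x * f x x) = of_real ((cmod (g x))\<^sup>2) * (cnj z * f x x)"
        by (simp add: complex_norm_square mult_ac del: of_real_power)
      then show "Re (cnj z * (cnj (g x) * g x * f x x)) = (cmod (g x))\<^sup>2 * Re (cnj z * f x x)"
        by (simp only: Re_mult_of_real)
    qed simp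
    finally have sum: "0 \<le> (\<Sum>x\<in>N. (cmod (g x))\<^sup>2 * Re (cnj z * f x x))" using S(5)[of y] y by simp
    have le: "(cmod (g x))\<^sup>2 * Re (cnj z * f x x) \<le> 0" if "x \<in> N" for x
      using that unfolding N_def mem_Collect_eq by (intro mult_nonneg_nonpos) auto
    have "(\<Sum>x\<in>N. (cmod (g x))\<^sup>2 * Re (cnj z * f x x)) = 0"
      using sum sum_nonpos[of N "\<lambda>x. (cmod (g x))\<^sup>2 * Re (cnj z * f x x)"] le by (intro antisym) auto
    then have "(\<Sum>x\<in>N. - ((cmod (g x))\<^sup>2 * Re (cnj z * f x x))) = 0" by (simp only: sum_negf)
    then have "(cmod (g x))\<^sup>2 * Re (cnj z * f x x) = 0" if "x \<in> N" for x
      using sum_nonneg_eq_0_iff[OF N(1), of "\<lambda>x. - ((cmod (g x))\<^sup>2 * Re (cnj z * f x x))"] le that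
      by (simp only: neg_0_le_iff_le neg_equal_0_iff_equal)
    then have "g x = 0" if "x \<in> N" for x using nz[of x] that unfolding N_def by fastforce
    then show "y \<in> {0}" by (simp add: g)
  qed
  note un = independent_Un[OF S(3,2) N(2,1) this]
  have "S \<union> N \<subseteq> span X" using S(1) by (auto simp: N_def intro: span_base)
  then have "card (S \<union> N) \<le> card X" using independent_span_bound[OF X(1) un(1)] by simp
  moreover have "card (S \<union> N) = k + card N" using card_Un_disjoint[OF S(2) N(1) un(2)] S(4) by simp
  moreover have "card X = card P + card N"
  proof -
    have "X = P \<union> N" using nz by (auto simp: P_def N_def linorder_neq_iff)
    then have "card X = card (P \<union> N)" by (rule arg_cong)
    also have "\<dots> = card P + card N"
      using X by (intro card_Un_disjoint) (auto simp: P_def N_def)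
    finally show ?thesis .
  qed
  ultimately show ?thesis unfolding P_def by linarith
qed

lemma nonneg_on_diagonal:
  assumes X: "finite X" "independent X" and orth: "\<And>x y. x \<in> X \<Longrightarrow> y \<in> X \<Longrightarrow> x \<noteq> y \<Longrightarrow> f x y = 0"
    and k: "k \<le> card {x\<in>X. Re (cnj z * f x x) > 0}"
  shows "nonneg_on (span X) k z"
proof (rule nonneg_on_antimono[OF _ _ _ k])
  define P where "P = {x\<in>X. Re (cnj z * f x x) > 0}"
  have P: "finite P" "P \<subseteq> X" using X by (auto simp: P_def)
  show "finite {x\<in>X. Re (cnj z * f x x) > 0}" "{x\<in>X. Re (cnj z * f x x) > 0} \<subseteq> span X"
    using X by (auto intro: span_base)
  show "independent {x\<in>X. Re (cnj z * f x x) > 0}" using X(2) by (rule independent_mono) auto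
  fix y assume "y \<in> span {x\<in>X. Re (cnj z * f x x) > 0}"
  then obtain g where g: "y = (\<Sum>x\<in>P. g x *s x)" using span_finite[OF P(1)] by (auto simp: P_def)
  have "f y y = (\<Sum>x\<in>P. cnj (g x) * g x * f x x)"
    unfolding g by (rule orthogonal_sum[OF P(1)]) (use P(2) orth in blast)
  then have "Re (cnj z * f y y) = (\<Sum>x\<in>P. Re (cnj z * (cnj (g x) * g x * f x x)))"
    by (simp only: sum_distrib_left Re_sum)
  also have "\<dots> \<ge> 0"
  proof (rule sum_nonneg)
    fix x assume x: "x \<in> P"
    have "cnj z * (cnj (g x) * g x * f x x) = of_real ((cmod (g x))\<^sup>2) * (cnj z * f x x)"
      by (simp add: complex_norm_square mult_ac del: of_real_power)
    then have "Re (cnj z * (cnj (g x) * g x * f x x)) = (cmod (g x))\<^sup>2 * Re (cnj z * f x x)"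
      by (simp only: Re_mult_of_real)
    then show "0 \<le> Re (cnj z * (cnj (g x) * g x * f x x))"
      using x unfolding P_def by (simp del: times_complex.sel)
  qed
  finally show "0 \<le> Re (cnj z * f y y)" .
qed

text \<open>The vectors \<open>v a\<close> with coordinates
  \<open>sqrt (\<omega> x) * s x ^ a\<close> make \<open>f (v a) (v b)\<close> the moment of order
  \<open>a + b\<close>. They are independent as in Vandermonde's argument: a relation is a
  polynomial of degree below \<open>r\<close> with \<open>card J\<close> roots.\<close>

lemma isotropic_moment_vectors:
  assumes J: "finite J" "independent J" and orth: "\<And>x y. x \<in> J \<Longrightarrow> y \<in> J \<Longrightarrow> x \<noteq> y \<Longrightarrow> f x y = 0"
    and inj: "inj_on s J" and r: "r \<le> card J" and \<omega>: "\<And>x. x \<in> J \<Longrightarrow> \<omega> x > (0::real)"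
    and moment: "\<And>m. m + 2 \<le> 2 * r \<Longrightarrow> (\<Sum>x\<in>J. of_real (\<omega> x * s x ^ m) * f x x) = 0"
  shows "isotropic_on (span J) r"
proof -
  define v where "v a = (\<Sum>x\<in>J. of_real (sqrt (\<omega> x) * s x ^ a) *s x)" for a
  have "g i = 0" if sum: "(\<Sum>a<r. g a *s v a) = 0" and i: "i \<in> {..<r}" for g i
  proof -
    define p where "p = (\<Sum>a<r. monom (g a) a)"
    have "(\<Sum>a<r. g a *s v a) = (\<Sum>a<r. \<Sum>x\<in>J. (g a * of_real (sqrt (\<omega> x) * s x ^ a)) *s x)"
      by (simp add: v_def scale_sum_right)
    also have "\<dots> = (\<Sum>x\<in>J. (of_real (sqrt (\<omega> x)) * poly p (of_real (s x))) *s x)"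
      by (subst sum.swap)
        (simp add: p_def poly_sum poly_monom scale_sum_left sum_distrib_left mult_ac)
    finally have "of_real (sqrt (\<omega> x)) * poly p (of_real (s x)) = 0" if "x \<in> J" for x
      using independentD[OF J(2,1) subset_refl, of "\<lambda>x. of_real (sqrt (\<omega> x)) * poly p (of_real (s x))" x]
        sum that by simp
    then have root: "poly p (of_real (s x)) = 0" if "x \<in> J" for x
      using \<omega>[OF that] that by fastforce
    have "p = 0"
    proof (rule ccontr)
      assume p: "p \<noteq> 0"
      have "card ((\<lambda>x. complex_of_real (s x)) ` J) \<le> card {x. poly p x = 0}"
        using p root by (intro card_mono poly_roots_finite) auto
      also have "\<dots> \<le> degree p" using p by (rule card_poly_roots_bound)
      also have "card ((\<lambda>x. complex_of_real (s x)) ` J) = card J"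
        using inj by (intro card_image) (auto simp: inj_on_def)
      also have "degree p \<le> r - 1" unfolding p_def
        by (intro degree_sum_le) (auto intro: order_trans[OF degree_monom_le])
      finally show False using r i by auto
    qed
    then have "coeff p i = 0" by simp
    then show "g i = 0" using i by (simp add: p_def coeff_sum)
  qed
  then have v: "inj_on v {..<r}" "independent (v ` {..<r})"
    using independent_family[of "{..<r}" v] by blast+
  have "f (v a) (v b) = 0" if "a < r" "b < r" for a b
  proof -
    have "f (v a) (v b) = (\<Sum>x\<in>J. cnj (of_real (sqrt (\<omega> x) * s x ^ a)) * of_real (sqrt (\<omega> x) * s x ^ b) * f x x)"
      unfolding v_def by (rule orthogonal_sum[OF J(1) orth])
    also have "\<dots> = (\<Sum>x\<in>J. of_real (\<omega> x * s x ^ (a + b)) * f x x)"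
    proof (rule sum.cong)
      fix x assume "x \<in> J"
      then have "sqrt (\<omega> x) * sqrt (\<omega> x) = \<omega> x" using \<omega>[of x] by simp
      then have "(sqrt (\<omega> x) * s x ^ a) * (sqrt (\<omega> x) * s x ^ b) = \<omega> x * s x ^ (a + b)"
        by (metis mult.assoc mult.left_commute power_add)
      then show "cnj (of_real (sqrt (\<omega> x) * s x ^ a)) * of_real (sqrt (\<omega> x) * s x ^ b) * f x x
          = of_real (\<omega> x * s x ^ (a + b)) * f x x"
        by (metis complex_cnj_complex_of_real of_real_mult)
    qed simp
    finally show ?thesis using moment[of "a + b"] that by simp
  qed
  moreover have "v a \<in> span J" for a unfolding v_def by (intro span_sum span_scale span_base)
  ultimately show ?thesis unfolding isotropic_on_def
    using v card_image[OF v(1)] by (intro exI[of _ "v ` {..<r}"]) auto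
qed

lemma isotropic_on_span_Un:
  assumes X: "finite X" "independent X" and orth: "\<And>x y. x \<in> X \<Longrightarrow> y \<in> X \<Longrightarrow> x \<noteq> y \<Longrightarrow> f x y = 0"
    and J: "J \<subseteq> X" and iso: "isotropic_on (span J) r" "isotropic_on (span (X - J)) k"
  shows "isotropic_on (span X) (r + k)"
proof -
  obtain S where S: "S \<subseteq> span J" "finite S" "independent S" "card S = r" "\<And>x y. x \<in> S \<Longrightarrow> y \<in> S \<Longrightarrow> f x y = 0"
    using iso(1) by (auto simp: isotropic_on_def)
  obtain T where T: "T \<subseteq> span (X - J)" "finite T" "independent T" "card T = k" "\<And>x y. x \<in> T \<Longrightarrow> y \<in> T \<Longrightarrow> f x y = 0"
    using iso(2) by (auto simp: isotropic_on_def)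
  have "span S \<subseteq> span J" "span T \<subseteq> span (X - J)"
    using span_minimal[OF S(1) subspace_span] span_minimal[OF T(1) subspace_span] .
  then have "span S \<inter> span T \<subseteq> {0}" using span_Int_span_Diff[OF X(2,1) J] by blast
  note un = independent_Un[OF S(3,2) T(3,2) this]
  have "f x y = 0 \<and> f y x = 0" if "x \<in> S" "y \<in> T" for x y
  proof
    have x: "x \<in> span J" and y: "y \<in> span (X - J)" using S(1) T(1) that by auto
    show "f x y = 0" by (rule span_orthogonal[OF _ x y]) (use J orth in blast)
    show "f y x = 0" by (rule span_orthogonal[OF _ y x]) (use J orth in blast)
  qed
  moreover have "S \<union> T \<subseteq> span X" using S(1) T(1) span_mono[OF J] span_mono[of "X - J" X] by auto
  ultimately show ?thesis unfolding isotropic_on_def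
    using S T un card_Un_disjoint[OF S(2) T(2) un(2)] by (intro exI[of _ "S \<union> T"]) auto
qed

text \<open>The set \<open>J\<close> given by \<open>balanced_subset\<close> contributes an
  isotropic subspace of dimension \<open>r\<close>, and \<open>IH\<close> for \<open>X - J\<close>
  contributes \<open>k - r\<close>. The subset is proper since \<open>card J\<close> is odd.\<close>

lemma isotropic_on_diagonal:
  assumes X: "finite X" "independent X" "X \<noteq> {}" and nz: "\<And>x. x \<in> X \<Longrightarrow> f x x \<noteq> 0"
    and orth: "\<And>x y. x \<in> X \<Longrightarrow> y \<in> X \<Longrightarrow> x \<noteq> y \<Longrightarrow> f x y = 0"
    and aniso: "\<And>x a b. pencil_eigenvector (span X) x a b \<Longrightarrow> f x x \<noteq> 0"
    and D: "finite D" "0 \<notin> D" and nn: "\<And>z. generic D z \<Longrightarrow> nonneg_on (span X) k z"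
    and IH: "\<And>Y D' k'. Y \<subset> X \<Longrightarrow> finite D' \<Longrightarrow> 0 \<notin> D' \<Longrightarrow>
      (\<And>z. generic D' z \<Longrightarrow> nonneg_on (span Y) k' z) \<Longrightarrow> isotropic_on (span Y) k'"
  shows "isotropic_on (span X) k"
proof -
  define c where "c x = f x x" for x
  have anti: "c x \<noteq> - of_real t * c y" if xy: "x \<in> X" "y \<in> X" and t: "t > 0" for x y t
  proof
    assume eq: "c x = - of_real t * c y"
    have "x \<noteq> y"
    proof
      assume "x = y"
      then have "c x = - (of_real t * c x)" using eq by simp
      then have "c x + of_real t * c x = 0" by (metis add.left_inverse)
      then have "(1 + of_real t) * c x = 0" by (simp add: distrib_right)
      moreover have "1 + complex_of_real t \<noteq> 0"
        using t by (simp add: complex_eq_iff)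
      ultimately show False using nz[OF xy(1)] by (simp add: c_def)
    qed
    then have fxy: "f x y = 0" "f y x = 0" using orth xy by auto
    \<comment> \<open>Opposite values cancel: with this \<open>r\<close> the vector
      \<open>x + r *s y\<close> is isotropic.\<close>
    define r where "r = complex_of_real (sqrt t)"
    have r: "cnj r = r" "r * r = of_real t"
      using t by (auto simp: r_def simp flip: of_real_mult)
    define v where "v = x + r *s y"
    have fv: "f w v = f w x + r * f w y" "f v w = f x w + r * f y w" for w
      by (simp_all add: v_def add_left add_right scale_left scale_right r)
    have "f v v = c x + (r * r) * c y"
      by (simp add: fv fxy c_def algebra_simps)
    then have fvv: "f v v = 0" using eq r by simp
    have "v \<in> span X" unfolding v_def using xy by (intro span_add span_scale span_base)
    moreover have "v \<noteq> 0" using fv(1)[of x] fxy nz[OF xy(1)] by auto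
    moreover have "cnj (c x) \<noteq> 0" using nz xy by (simp add: c_def)
    \<comment> \<open>The coefficients are dictated by \<open>w = x\<close>; they also work for
      \<open>w = y\<close> because \<open>c x\<close> and \<open>c y\<close> lie on one real line.
      So \<open>v\<close> is an isotropic eigenvector, against \<open>aniso\<close>.\<close>
    moreover have "cnj (c x) * f w v + (- c x) * cnj (f v w) = 0" if "w \<in> X" for w
    proof -
      consider "w = x" | "w = y" | "w \<noteq> x" "w \<noteq> y" by blast
      then show ?thesis
      proof cases
        case 1
        then show ?thesis by (simp add: fv fxy c_def)
      next
        case 2
        then have "f w v = r * c y" "cnj (f v w) = r * cnj (c y)" by (auto simp: fv fxy c_def r)
        then show ?thesis using eq by simp
      next
        case 3
        then show ?thesis using orth that xy by (simp add: fv)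
      qed
    qed
    then have "span X \<subseteq> {w. cnj (c x) * f w v + (- c x) * cnj (f v w) = 0}"
      by (intro span_minimal subspace_pencil) auto
    ultimately have "pencil_eigenvector (span X) v (cnj (c x)) (- c x)"
      unfolding pencil_eigenvector_def by blast
    then show False using aniso fvv by blast
  qed
  have D': "finite (D \<union> c ` X)" "0 \<notin> D \<union> c ` X" using D X nz by (auto simp: c_def)
  have count: "k \<le> card {x\<in>X. Re (cnj z * c x) > 0}" if "generic (D \<union> c ` X) z" for z
    unfolding c_def
  proof (rule card_pos_of_nonneg_on[OF X(1,2) orth])
    show "nonneg_on (span X) k z" using nn that by (simp add: generic_Un)
    show "Re (cnj z * f x x) \<noteq> 0" if "x \<in> X" for x
      using \<open>generic (D \<union> c ` X) z\<close> that by (auto simp: generic_def c_def)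
  qed
  have c0: "c x \<noteq> 0" if "x \<in> X" for x using nz[OF that] by (simp add: c_def)
  obtain J r \<omega> s D2 where J: "J \<subseteq> X" "card J = 2 * r + 1" "inj_on s J" "\<And>x. x \<in> J \<Longrightarrow> \<omega> x > (0::real)"
    "\<And>m. m + 2 \<le> 2 * r \<Longrightarrow> (\<Sum>x\<in>J. of_real (\<omega> x * s x ^ m) * c x) = 0"
    and D2: "finite D2" "0 \<notin> D2"
    and rest: "\<And>z. generic D2 z \<Longrightarrow> k - r \<le> card {x\<in>X - J. Re (cnj z * c x) > 0}"
    by (rule balanced_subset[OF X(1,3) c0 anti D' count]) (assumption | rule that)+
  have finJ: "finite J" and indJ: "independent J" "independent (X - J)"
    using finite_subset[OF J(1) X(1)] independent_mono[OF X(2)] J(1) by auto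
  have "isotropic_on (span J) r"
  proof (rule isotropic_moment_vectors[OF finJ indJ(1) _ J(3) _ J(4)])
    show "f x y = 0" if "x \<in> J" "y \<in> J" "x \<noteq> y" for x y using orth J(1) that by blast
    show "r \<le> card J" using J(2) by simp
    show "(\<Sum>x\<in>J. of_real (\<omega> x * s x ^ m) * f x x) = 0" if "m + 2 \<le> 2 * r" for m
      using J(5)[OF that] by (simp only: c_def)
  qed
  moreover have "isotropic_on (span (X - J)) (k - r)"
  proof (rule IH[OF _ D2])
    have "J \<noteq> {}" using J(2) by auto
    then show "X - J \<subset> X" using J(1) by blast
    fix z assume z: "generic D2 z"
    show "nonneg_on (span (X - J)) (k - r) z"
    proof (rule nonneg_on_diagonal[OF _ indJ(2)])
      show "f x y = 0" if "x \<in> X - J" "y \<in> X - J" "x \<noteq> y" for x y using orth that by blast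
      show "k - r \<le> card {x\<in>X - J. Re (cnj z * f x x) > 0}" using rest[OF z] by (simp only: c_def)
    qed (use X in auto)
  qed
  \<comment> \<open>Subtraction is truncated: for \<open>r > k\<close> the sum exceeds
    \<open>k\<close>, and a subset of the vectors is taken.\<close>
  ultimately have "isotropic_on (span X) (r + (k - r))"
    by (intro isotropic_on_span_Un[OF X(1,2) orth J(1)])
  then obtain S where "S \<subseteq> span X" "finite S" "independent S" "card S = r + (k - r)"
    "\<And>x y. x \<in> S \<Longrightarrow> y \<in> S \<Longrightarrow> f x y = 0"
    by (auto simp: isotropic_on_def)
  then show ?thesis by (intro isotropic_on_antimono[of S]) auto
qed

text \<open>The smaller problem is solved in a complement \<open>span C\<close> of \<open>x\<close>
  in \<open>perp U x\<close>; then \<open>x\<close> is adjoined, being isotropic and orthogonal to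
  it on both sides.\<close>

lemma isotropic_on_reduce:
  assumes U: "subspace U" "U \<subseteq> span B" "finite B" and x: "pencil_eigenvector U x a b" "f x x = 0"
    and D: "finite D" "0 \<notin> D" and nn: "\<And>z. generic D z \<Longrightarrow> nonneg_on U (Suc k) z"
    and IH: "\<And>C D'. finite C \<Longrightarrow> card C < card B \<Longrightarrow> finite D' \<Longrightarrow> 0 \<notin> D' \<Longrightarrow>
      (\<And>z. generic D' z \<Longrightarrow> nonneg_on (span C) k z) \<Longrightarrow> isotropic_on (span C) k"
  shows "isotropic_on U (Suc k)"
proof -
  have xU: "x \<in> U" "x \<noteq> 0" using x by (auto simp: pencil_eigenvector_def)
  define W where "W = perp U x"
  have W: "subspace W" "W \<subseteq> U" "x \<in> W"
    using subspace_perp[OF U(1)] xU x(2) by (auto simp: W_def perp_def)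
  obtain C0 where C0: "{x} \<subseteq> C0" "C0 \<subseteq> W" "independent C0" "W \<subseteq> span C0"
    using maximal_independent_subset_extend[of "{x}" W] W(3) xU(2) by auto
  define C where "C = C0 - {x}"
  have C0eq: "C0 = insert x C" "x \<notin> C" using C0(1) by (auto simp: C_def)
  have "C0 \<subseteq> span B" using C0(2) W(2) U(2) by blast
  then have fin0: "finite C0 \<and> card C0 \<le> card B" by (rule independent_span_bound[OF U(3) C0(3)])
  then have finC: "finite C" and cardC: "card C < card B" unfolding C0eq(1) using C0eq(2) by auto
  have xC: "x \<notin> span C" using C0(3) C0eq by (simp add: independent_insert)
  have spC: "span C \<subseteq> W" using C0(2) W(1) by (intro span_minimal) (auto simp: C_def)
  obtain d where d: "d \<noteq> 0" "\<And>z y. Re (cnj z * d) \<noteq> 0 \<Longrightarrow> y \<in> U \<Longrightarrow>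
    cnj z * f x y + z * cnj (f y x) = 0 \<Longrightarrow> f x y = 0 \<and> f y x = 0"
    using pencil_exceptional_line[OF x(1)] by blast
  obtain \<phi> where ker: "\<And>y z. \<phi> (y + z) = \<phi> y + \<phi> z" "\<And>c y. \<phi> (c *s y) = c * \<phi> y"
    "\<And>y. y \<in> U \<Longrightarrow> \<phi> y = 0 \<Longrightarrow> y \<in> perp U x"
    using perp_kernel[OF x(1)] by blast
  have "isotropic_on (span C) k"
  proof (rule IH[OF finC cardC])
    \<comment> \<open>Directions perpendicular to \<open>d\<close> are given up: there nonnegativity
      need not force orthogonality to \<open>x\<close>.\<close>
    show "finite (insert d D)" "0 \<notin> insert d D" using D d(1) by auto
    fix z assume z: "generic (insert d D) z"
    then have zd: "Re (cnj z * d) \<noteq> 0" and zD: "generic D z" by (auto simp: generic_def)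
    show "nonneg_on (span C) k z"
      by (rule nonneg_on_reduce[OF U(1) xU(1) x(2) ker d(2)[OF zd] _ nn[OF zD]])
        (use C0(4) C0eq in \<open>auto simp: W_def\<close>)
  qed
  then obtain S where S: "S \<subseteq> span C" "finite S" "independent S" "card S = k"
    "\<And>x y. x \<in> S \<Longrightarrow> y \<in> S \<Longrightarrow> f x y = 0"
    by (auto simp: isotropic_on_def)
  have "span S \<subseteq> span C" using S(1) by (intro span_minimal subspace_span)
  then have xS: "x \<notin> span S" "x \<notin> S" using xC S(1) by auto
  have "f x y = 0" "f y x = 0" if "y \<in> S" for y
    using that S(1) spC by (auto simp: W_def perp_def)
  moreover have "independent (insert x S)" using xS(1) S(3) by (rule independent_insertI)
  ultimately show ?thesis
    unfolding isotropic_on_def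
    using S xS xU(1) x(2) spC W(2) by (intro exI[of _ "insert x S"]) auto
qed

text \<open>The spanning set \<open>B\<close> bounds the dimension and drives the induction.
  \<open>U\<close>, \<open>D\<close> and \<open>k\<close> vary, as a reduction shrinks the space,
  may add exceptional lines and may lower \<open>k\<close>.\<close>

theorem isotropic_on_if_nonneg_on:
  assumes "subspace U" "U \<subseteq> span B" "finite B" "finite D" "0 \<notin> D"
    and "\<And>z. generic D z \<Longrightarrow> nonneg_on U k z"
  shows "isotropic_on U k"
  using assms
proof (induction "card B" arbitrary: U B D k rule: less_induct)
  case less
  note U = less.prems(1-3) and D = less.prems(4,5) and nn = less.prems(6)
  have IH: "isotropic_on (span C) k'"
    if "finite C" "card C < card B" "finite D'" "0 \<notin> D'" "\<And>z. generic D' z \<Longrightarrow> nonneg_on (span C) k' z"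
    for C D' k'
    by (rule less.hyps[OF that(2) subspace_span subset_refl that(1,3,4)]) (rule that(5))
  show ?case
  proof (cases k)
    case 0
    then show ?thesis by (auto simp: isotropic_on_def intro!: exI[of _ "{}"] independent_empty)
  next
    case (Suc k')
    show ?thesis
    proof (cases "\<exists>x a b. pencil_eigenvector U x a b \<and> f x x = 0")
      case True
      then obtain x a b where x: "pencil_eigenvector U x a b" "f x x = 0" by blast
      show ?thesis unfolding Suc
      proof (rule isotropic_on_reduce[OF U x D])
        show "nonneg_on U (Suc k') z" if "generic D z" for z using nn[OF that] Suc by simp
      qed (rule IH)
    next
      case False
      then have aniso: "\<And>x a b. pencil_eigenvector U x a b \<Longrightarrow> f x x \<noteq> 0" by blast
      have "\<exists>X. finite X \<and> independent X \<and> X \<subseteq> U \<and> span X = U \<and>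
        (\<forall>x\<in>X. f x x \<noteq> 0) \<and> (\<forall>x\<in>X. \<forall>y\<in>X. x \<noteq> y \<longrightarrow> f x y = 0)"
        by (rule orthogonal_basis[OF U]) (rule aniso)
      then obtain X where X: "finite X" "independent X" "X \<subseteq> U" "span X = U"
        "\<forall>x\<in>X. f x x \<noteq> 0" "\<forall>x\<in>X. \<forall>y\<in>X. x \<noteq> y \<longrightarrow> f x y = 0"
        by (elim exE conjE)
      have cardX: "card X \<le> card B" using independent_span_bound[OF U(3) X(2)] X(3) U(2) by auto
      \<comment> \<open>Here \<open>k\<close> is positive, while a zero space contains no nonempty
        independent set.\<close>
      have "X \<noteq> {}"
      proof
        assume "X = {}"
        then have U0: "U = {0}" using X(4) by simp
        obtain z where "generic D z" using ex_generic_in_interval[OF D, of 1 0 1] by auto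
        then obtain S where "S \<subseteq> {0}" "independent S" "card S = Suc k'"
          using nn Suc U0 unfolding nonneg_on_def by blast
        then show False using dependent_zero[of S] by (cases "S = {}") auto
      qed
      have "isotropic_on (span X) k"
      proof (rule isotropic_on_diagonal[OF X(1,2) \<open>X \<noteq> {}\<close> _ _ _ D])
        show "isotropic_on (span Y) k''"
          if Y: "Y \<subset> X" and D': "finite D'" "0 \<notin> D'"
            and nnY: "\<And>z. generic D' z \<Longrightarrow> nonneg_on (span Y) k'' z" for Y D' k''
        proof (rule IH[OF _ _ D'])
          show "finite Y" using Y X(1) finite_subset by blast
          show "card Y < card B" using psubset_card_mono[OF X(1) Y] cardX by simp
        qed (rule nnY)
      qed (use X aniso nn in auto)
      then show ?thesis using X(4) by simp
    qed
  qed
qed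

end

section \<open>Matrices\<close>

lemma mat_adjoint_carrier: "A \<in> carrier_mat n m \<Longrightarrow> mat_adjoint A \<in> carrier_mat m n"
  by (auto simp: mat_adjoint_def)

lemma index_mat_adjoint:
  "i < dim_col A \<Longrightarrow> j < dim_row A \<Longrightarrow> mat_adjoint A $$ (i, j) = cnj (A $$ (j, i))"
  by (auto simp: mat_adjoint_def mat_of_rows_def)

text \<open>Vectors are functions on all of \<open>nat\<close>, so that they form a type with
  pointwise group operations, as \<open>vector_space\<close> expects; \<open>coord_space n\<close>
  plays the role of n-space.\<close>

definition cscale :: "complex \<Rightarrow> (nat \<Rightarrow> complex) \<Rightarrow> nat \<Rightarrow> complex" where
  "cscale c v = (\<lambda>i. c * v i)"

definition mat_form :: "complex mat \<Rightarrow> (nat \<Rightarrow> complex) \<Rightarrow> (nat \<Rightarrow> complex) \<Rightarrow> complex" where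
  "mat_form A x y = (\<Sum>i<dim_row A. \<Sum>j<dim_col A. cnj (x i) * A $$ (i, j) * y j)"

definition coord_space :: "nat \<Rightarrow> (nat \<Rightarrow> complex) set" where
  "coord_space n = {v. \<forall>i\<ge>n. v i = 0}"

interpretation cfun: vector_space cscale
  by unfold_locales (auto simp: cscale_def fun_eq_iff algebra_simps)

interpretation form: sesquilinear_space cscale "mat_form A" for A
  by unfold_locales
    (auto simp: mat_form_def cscale_def sum.distrib sum_distrib_left algebra_simps)

lemma subspace_coord_space: "cfun.subspace (coord_space n)"
  by (rule cfun.subspaceI) (auto simp: coord_space_def cscale_def)

lemma coord_space_spanned:
  obtains B where "finite B" "card B \<le> n" "coord_space n \<subseteq> cfun.span B"
proof
  let ?e = "\<lambda>i j. if j = i then 1 else 0 :: complex"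
  show "finite (?e ` {..<n})" "card (?e ` {..<n}) \<le> n"
    using card_image_le[of "{..<n}" ?e] by auto
  show "coord_space n \<subseteq> cfun.span (?e ` {..<n})"
  proof
    fix v assume v: "v \<in> coord_space n"
    have "(\<Sum>i<n. cscale (v i) (?e i)) j = v j" for j
    proof -
      have "(\<Sum>i<n. cscale (v i) (?e i)) j = (\<Sum>i<n. cscale (v i) (?e i) j)"
        by (induction n) auto
      also have "\<dots> = (\<Sum>i<n. if i = j then v j else 0)"
        by (rule sum.cong) (auto simp: cscale_def)
      finally show ?thesis using v by (auto simp: coord_space_def)
    qed
    then have "v = (\<Sum>i<n. cscale (v i) (?e i))" by (simp add: fun_eq_iff)
    also have "\<dots> \<in> cfun.span (?e ` {..<n})"
      by (intro cfun.span_sum cfun.span_scale cfun.span_base) auto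
    finally show "v \<in> cfun.span (?e ` {..<n})" .
  qed
qed

lemma mat_form_one: "mat_form (1\<^sub>m n) x y = (\<Sum>i<n. cnj (x i) * y i)"
proof -
  have "mat_form (1\<^sub>m n) x y = (\<Sum>i<n. \<Sum>j<n. if j = i then cnj (x i) * y i else 0)"
    unfolding mat_form_def by (intro sum.cong) auto
  then show ?thesis by simp
qed

lemma mat_form_one_self: "mat_form (1\<^sub>m n) x x = of_real (\<Sum>i<n. (cmod (x i))\<^sup>2)"
  by (simp add: mat_form_one complex_norm_square mult.commute del: of_real_power)

lemma mat_form_one_definite:
  assumes "x \<in> coord_space n" "x \<noteq> 0"
  shows "0 < (\<Sum>i<n. (cmod (x i))\<^sup>2)"
proof -
  obtain i where "x i \<noteq> 0" using assms(2) by (auto simp: fun_eq_iff)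
  moreover from this have "i < n" using assms(1) by (auto simp: coord_space_def not_less[symmetric])
  ultimately show ?thesis by (intro sum_pos2[of _ i]) auto
qed

lemma congruence_index:
  assumes A: "A \<in> carrier_mat n n" and V: "V \<in> carrier_mat n k" and ab: "a < k" "b < k"
  shows "(mat_adjoint V * A * V) $$ (a, b) = mat_form A (\<lambda>i. V $$ (i, a)) (\<lambda>i. V $$ (i, b))"
proof -
  have V': "mat_adjoint V \<in> carrier_mat k n" using V by (rule mat_adjoint_carrier)
  have "(mat_adjoint V * A * V) $$ (a, b) = (\<Sum>j<n. (mat_adjoint V * A) $$ (a, j) * V $$ (j, b))"
    using A V V' ab
    by (subst index_mult_mat) (auto simp: scalar_prod_def atLeast0LessThan simp del: assoc_mult_mat)
  also have "\<dots> = (\<Sum>j<n. \<Sum>i<n. cnj (V $$ (i, a)) * A $$ (i, j) * V $$ (j, b))"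
  proof (rule sum.cong)
    fix j assume "j \<in> {..<n}"
    then have "(mat_adjoint V * A) $$ (a, j) = (\<Sum>i<n. cnj (V $$ (i, a)) * A $$ (i, j))"
      using A V V' ab by (simp add: scalar_prod_def atLeast0LessThan index_mat_adjoint)
    then show "(mat_adjoint V * A) $$ (a, j) * V $$ (j, b)
        = (\<Sum>i<n. cnj (V $$ (i, a)) * A $$ (i, j) * V $$ (j, b))"
      by (simp add: sum_distrib_right)
  qed simp
  also have "\<dots> = (\<Sum>i<n. \<Sum>j<n. cnj (V $$ (i, a)) * A $$ (i, j) * V $$ (j, b))"
    by (rule sum.swap)
  finally show ?thesis using A by (simp add: mat_form_def)
qed

lemma mat_form_cong:
  assumes "A \<in> carrier_mat n n" "\<And>i. i < n \<Longrightarrow> x i = x' i" "\<And>i. i < n \<Longrightarrow> y i = y' i"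
  shows "mat_form A x y = mat_form A x' y'"
  unfolding mat_form_def using assms by (auto intro!: sum.cong)

text \<open>The standard inner product is the form of \<open>1\<^sub>m n\<close>. It is definite, so
  \<open>orthogonal_basis\<close> applies in place of Gram-Schmidt, and dividing by the norms
  finishes.\<close>

lemma orthonormal_family:
  assumes S: "finite S" "cfun.independent S" "S \<subseteq> coord_space n"
  obtains u where "\<And>j. j < card S \<Longrightarrow> u j \<in> cfun.span S"
    "\<And>i j. i < card S \<Longrightarrow> j < card S \<Longrightarrow> mat_form (1\<^sub>m n) (u i) (u j) = (if i = j then 1 else 0)"
proof -
  have sub: "cfun.span S \<subseteq> coord_space n"
    using S(3) subspace_coord_space by (rule cfun.span_minimal)
  define q where "q x = sqrt (\<Sum>i<n. (cmod (x i))\<^sup>2)" for x :: "nat \<Rightarrow> complex"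
  have q: "q x > 0" "mat_form (1\<^sub>m n) x x = of_real (q x) * of_real (q x)"
    if "x \<in> cfun.span S" "x \<noteq> 0" for x
    using mat_form_one_definite[of x n] that sub
    by (auto simp: q_def mat_form_one_self simp flip: of_real_mult)
  have "\<exists>X. finite X \<and> cfun.independent X \<and> X \<subseteq> cfun.span S \<and> cfun.span X = cfun.span S \<and>
    (\<forall>x\<in>X. mat_form (1\<^sub>m n) x x \<noteq> 0) \<and> (\<forall>x\<in>X. \<forall>y\<in>X. x \<noteq> y \<longrightarrow> mat_form (1\<^sub>m n) x y = 0)"
  proof (rule form.orthogonal_basis[OF cfun.subspace_span subset_refl S(1)])
    fix x a b assume "form.pencil_eigenvector (1\<^sub>m n) (cfun.span S) x a b"
    then have "x \<in> cfun.span S" "x \<noteq> 0" by (auto simp: form.pencil_eigenvector_def)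
    then show "mat_form (1\<^sub>m n) x x \<noteq> 0" using q[of x] by auto
  qed
  then obtain X where X: "finite X" "cfun.independent X" "X \<subseteq> cfun.span S" "cfun.span X = cfun.span S"
    "\<forall>x\<in>X. \<forall>y\<in>X. x \<noteq> y \<longrightarrow> mat_form (1\<^sub>m n) x y = 0"
    by (elim exE conjE)
  have "card X \<le> card S" using cfun.independent_span_bound[OF S(1) X(2,3)] by simp
  moreover have "S \<subseteq> cfun.span X" using X(4) cfun.span_superset by blast
  then have "card S \<le> card X" using cfun.independent_span_bound[OF X(1) S(2)] by simp
  ultimately have card: "card X = card S" by simp
  obtain h where h: "bij_betw h {..<card S} X"
    using ex_bij_betw_nat_finite[OF X(1)] card by (auto simp: atLeast0LessThan)
  have hX: "h j \<in> X" if "j < card S" for j using h that by (auto simp: bij_betw_def)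
  have hne: "h j \<noteq> 0" if "j < card S" for j
    using hX[OF that] X(2) cfun.dependent_zero by metis
  show ?thesis
  proof (rule that[of "\<lambda>j. cscale (of_real (1 / q (h j))) (h j)"])
    show "cscale (of_real (1 / q (h j))) (h j) \<in> cfun.span S" if "j < card S" for j
      using hX[OF that] X(3) by (intro cfun.span_scale) auto
    fix i j assume ij: "i < card S" "j < card S"
    have eq: "mat_form (1\<^sub>m n) (cscale (of_real (1 / q (h i))) (h i)) (cscale (of_real (1 / q (h j))) (h j))
        = of_real (1 / q (h i)) * (of_real (1 / q (h j)) * mat_form (1\<^sub>m n) (h i) (h j))"
      by (simp add: form.scale_left form.scale_right)
    show "mat_form (1\<^sub>m n) (cscale (of_real (1 / q (h i))) (h i)) (cscale (of_real (1 / q (h j))) (h j))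
        = (if i = j then 1 else 0)"
    proof (cases "i = j")
      case True
      have "h j \<in> cfun.span S" using hX[OF ij(2)] X(3) by auto
      then show ?thesis unfolding eq using True q[OF _ hne[OF ij(2)]] by simp
    next
      case False
      then have "h i \<noteq> h j" using h ij by (auto simp: bij_betw_def inj_on_def)
      then show ?thesis unfolding eq using False X(5) hX ij by simp
    qed
  qed
qed

text \<open>The columns of \<open>V\<close> form an orthonormal basis of an isotropic subspace.
  Conversely, an isotropic independent set is orthonormalised inside its span, where the form still
  vanishes.\<close>

lemma has_zero_dilation_iff:
  assumes A: "A \<in> carrier_mat n n"
  shows "has_zero_dilation A k \<longleftrightarrow> form.isotropic_on A (coord_space n) k"
proof
  assume "has_zero_dilation A k"
  then obtain V where V: "V \<in> carrier_mat n k" "mat_adjoint V * V = 1\<^sub>m k"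
    "mat_adjoint V * A * V = 0\<^sub>m k k"
    using A by (auto simp: has_zero_dilation_def)
  \<comment> \<open>Extended by \<open>0\<close> to lie in \<open>coord_space n\<close>; entries of
    \<open>V\<close> outside its dimensions are unspecified.\<close>
  define v where "v j = (\<lambda>i. if i < n then V $$ (i, j) else 0)" for j
  have V': "mat_adjoint V \<in> carrier_mat k n" using V(1) by (rule mat_adjoint_carrier)
  have fv: "mat_form B (v a) (v b) = (mat_adjoint V * B * V) $$ (a, b)"
    if "B \<in> carrier_mat n n" "a < k" "b < k" for B a b
    unfolding congruence_index[OF that(1) V(1) that(2,3)]
    by (rule mat_form_cong[OF that(1)]) (auto simp: v_def)
  have one: "mat_form (1\<^sub>m n) (v a) (v b) = (if a = b then 1 else 0)" if "a < k" "b < k" for a b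
    using fv[of "1\<^sub>m n" a b] that V(2) V' by simp
  have "g i = 0" if sum: "(\<Sum>j<k. cscale (g j) (v j)) = 0" and i: "i \<in> {..<k}" for g i
  proof -
    have "0 = mat_form (1\<^sub>m n) (v i) (\<Sum>j<k. cscale (g j) (v j))"
      unfolding sum by simp
    also have "\<dots> = (\<Sum>j<k. g j * mat_form (1\<^sub>m n) (v i) (v j))"
      by (simp add: form.sum_right form.scale_right)
    also have "\<dots> = (\<Sum>j<k. if j = i then g i else 0)"
      using i by (intro sum.cong) (auto simp: one)
    finally show ?thesis using i by simp
  qed
  then have ind: "inj_on v {..<k}" "cfun.independent (v ` {..<k})"
    using cfun.independent_family[of "{..<k}" v] by blast+
  moreover have "mat_form A (v a) (v b) = 0" if "a < k" "b < k" for a b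
    using fv[OF A that] V(3) that by simp
  moreover have "v j \<in> coord_space n" for j by (simp add: v_def coord_space_def)
  ultimately show "form.isotropic_on A (coord_space n) k"
    unfolding form.isotropic_on_def
    using card_image[OF ind(1)] by (intro exI[of _ "v ` {..<k}"]) auto
next
  assume "form.isotropic_on A (coord_space n) k"
  then obtain S where S: "S \<subseteq> coord_space n" "finite S" "cfun.independent S" "card S = k"
    "\<And>x y. x \<in> S \<Longrightarrow> y \<in> S \<Longrightarrow> mat_form A x y = 0"
    by (auto simp: form.isotropic_on_def)
  obtain u where u: "\<And>j. j < k \<Longrightarrow> u j \<in> cfun.span S"
    "\<And>i j. i < k \<Longrightarrow> j < k \<Longrightarrow> mat_form (1\<^sub>m n) (u i) (u j) = (if i = j then 1 else 0)"
    using orthonormal_family[OF S(2,3,1)] S(4) by metis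
  define V where "V = mat n k (\<lambda>(i, j). u j i)"
  have V: "V \<in> carrier_mat n k" by (simp add: V_def)
  then have V': "mat_adjoint V \<in> carrier_mat k n" by (rule mat_adjoint_carrier)
  have fu: "(mat_adjoint V * B * V) $$ (a, b) = mat_form B (u a) (u b)"
    if "B \<in> carrier_mat n n" "a < k" "b < k" for B a b
    unfolding congruence_index[OF that(1) V that(2,3)]
    by (rule mat_form_cong[OF that(1)]) (use that in \<open>auto simp: V_def\<close>)
  have "mat_adjoint V * V = 1\<^sub>m k"
  proof (rule eq_matI)
    fix a b assume "a < dim_row (1\<^sub>m k)" "b < dim_col (1\<^sub>m k)"
    then show "(mat_adjoint V * V) $$ (a, b) = 1\<^sub>m k $$ (a, b)"
      using fu[of "1\<^sub>m n" a b] u(2) V V' by simp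
  qed (use V V' in auto)
  moreover have "mat_adjoint V * A * V = 0\<^sub>m k k"
  proof (rule eq_matI)
    fix a b assume ab: "a < dim_row (0\<^sub>m k k :: complex mat)" "b < dim_col (0\<^sub>m k k :: complex mat)"
    then have "mat_form A (u a) (u b) = 0"
      using form.span_orthogonal[OF S(5), of S S] u(1) by auto
    then show "(mat_adjoint V * A * V) $$ (a, b) = 0\<^sub>m k k $$ (a, b)"
      using fu[OF A, of a b] ab by simp
  qed (use V V' in auto)
  ultimately show "has_zero_dilation A k" using V A by (auto simp: has_zero_dilation_def)
qed

section \<open>The zero-dilation index and hermitian parts\<close>

lemma has_zero_dilation_0: "A \<in> carrier_mat n n \<Longrightarrow> has_zero_dilation A 0"
  by (auto simp: has_zero_dilation_iff form.isotropic_on_def intro!: exI[of _ "{}"] cfun.independent_empty)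

lemma has_zero_dilation_le:
  assumes "A \<in> carrier_mat n n" "has_zero_dilation A k"
  shows "k \<le> n"
proof -
  obtain S where S: "S \<subseteq> coord_space n" "cfun.independent S" "card S = k"
    using assms by (auto simp: has_zero_dilation_iff form.isotropic_on_def)
  obtain B where B: "finite B" "card B \<le> n" "coord_space n \<subseteq> cfun.span B"
    by (rule coord_space_spanned)
  have "S \<subseteq> cfun.span B" using S(1) B(3) by (rule subset_trans)
  then show ?thesis using cfun.independent_span_bound[OF B(1) S(2)] S(3) B(2) by simp
qed

lemma has_zero_dilation_antimono:
  assumes A: "A \<in> carrier_mat n n" and "has_zero_dilation A k" "j \<le> k"
  shows "has_zero_dilation A j"
proof -
  obtain S where "S \<subseteq> coord_space n" "finite S" "cfun.independent S" "card S = k"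
    "\<And>x y. x \<in> S \<Longrightarrow> y \<in> S \<Longrightarrow> mat_form A x y = 0"
    using assms by (auto simp: has_zero_dilation_iff form.isotropic_on_def)
  then show ?thesis unfolding has_zero_dilation_iff[OF A]
    using assms(3) by (intro form.isotropic_on_antimono[of S]) auto
qed

text \<open>The sizes of zero dilations form an initial segment bounded by \<open>n\<close>, so
  \<open>GREATEST\<close> is attained. Size \<open>0\<close> always occurs, in agreement with the
  default value \<open>0\<close>.\<close>

lemma le_zero_dilation_index_iff:
  assumes A: "A \<in> carrier_mat n n"
  shows "k \<le> zero_dilation_index A \<longleftrightarrow> has_zero_dilation A k"
proof (cases "\<exists>k\<ge>1. has_zero_dilation A k")
  case False
  then show ?thesis
    using has_zero_dilation_0[OF A] by (cases k) (auto simp: zero_dilation_index_def)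
next
  case True
  define d where "d = zero_dilation_index A"
  have d_eq: "d = (GREATEST k. k \<ge> 1 \<and> has_zero_dilation A k)"
    using True by (simp add: d_def zero_dilation_index_def)
  have bound: "\<forall>k. k \<ge> 1 \<and> has_zero_dilation A k \<longrightarrow> k \<le> n"
    using has_zero_dilation_le[OF A] by blast
  obtain k0 where k0: "k0 \<ge> 1 \<and> has_zero_dilation A k0" using True by blast
  have d: "d \<ge> 1 \<and> has_zero_dilation A d"
    unfolding d_eq by (rule GreatestI_nat[where P = "\<lambda>k. k \<ge> 1 \<and> has_zero_dilation A k", OF k0, of n])
      (use bound in blast)
  have "k \<le> d" if "has_zero_dilation A k"
  proof (cases "k = 0")
    case False
    then show ?thesis
      unfolding d_eq using that bound
      by (intro Greatest_le_nat[where P = "\<lambda>k. k \<ge> 1 \<and> has_zero_dilation A k", of k n]) auto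
  qed simp
  then show ?thesis using has_zero_dilation_antimono[OF A, of d k] d unfolding d_def by blast
qed

lemma Re_mat_carrier: "A \<in> carrier_mat n n \<Longrightarrow> Re_mat (c \<cdot>\<^sub>m A) \<in> carrier_mat n n"
  using mat_adjoint_carrier[of "c \<cdot>\<^sub>m A" n n] by (simp add: Re_mat_def)

lemma mat_form_Re_mat:
  assumes A: "A \<in> carrier_mat n n"
  shows "mat_form (Re_mat (c \<cdot>\<^sub>m A)) x y = (c * mat_form A x y + cnj (c * mat_form A y x)) / 2"
proof -
  have ent: "Re_mat (c \<cdot>\<^sub>m A) $$ (i, j) = (c * A $$ (i, j) + cnj (c * A $$ (j, i))) / 2"
    if "i < n" "j < n" for i j
    using that A mat_adjoint_carrier[of "c \<cdot>\<^sub>m A" n n]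
    by (simp add: Re_mat_def index_mat_adjoint)
  have "mat_form (Re_mat (c \<cdot>\<^sub>m A)) x y =
      (\<Sum>i<n. \<Sum>j<n. (c * (cnj (x i) * A $$ (i, j) * y j) + cnj (c * (cnj (y j) * A $$ (j, i) * x i))) / 2)"
    unfolding mat_form_def using Re_mat_carrier[OF A, of c]
    by (intro sum.cong) (auto simp: ent algebra_simps add_divide_distrib)
  also have "\<dots> = ((\<Sum>i<n. \<Sum>j<n. c * (cnj (x i) * A $$ (i, j) * y j))
      + (\<Sum>i<n. \<Sum>j<n. cnj (c * (cnj (y j) * A $$ (j, i) * x i)))) / 2"
    by (simp only: sum.distrib sum_divide_distrib add_divide_distrib)
  also have "(\<Sum>i<n. \<Sum>j<n. c * (cnj (x i) * A $$ (i, j) * y j)) = c * mat_form A x y"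
    using A by (simp add: mat_form_def sum_distrib_left)
  also have "(\<Sum>i<n. \<Sum>j<n. cnj (c * (cnj (y j) * A $$ (j, i) * x i)))
      = (\<Sum>j<n. \<Sum>i<n. cnj (c * (cnj (y j) * A $$ (j, i) * x i)))"
    by (rule sum.swap)
  also have "\<dots> = cnj (c * mat_form A y x)"
    using A by (simp add: mat_form_def sum_distrib_left)
  finally show ?thesis .
qed

text \<open>This gives the easy inequality: a subspace isotropic for \<open>A\<close> serves for
  every angle.\<close>

lemma has_zero_dilation_Re_mat:
  assumes A: "A \<in> carrier_mat n n" and "has_zero_dilation A k"
  shows "has_zero_dilation (Re_mat (c \<cdot>\<^sub>m A)) k"
  using assms(2) unfolding has_zero_dilation_iff[OF A] has_zero_dilation_iff[OF Re_mat_carrier[OF A]]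
    form.isotropic_on_def mat_form_Re_mat[OF A]
  by fastforce

text \<open>Up to the positive factor \<open>cmod z\<close>, \<open>cnj z\<close> is the rotation by
  \<open>- Arg z\<close>. The hermitian form in direction \<open>z\<close> thus vanishes on the span
  of the dilation vectors.\<close>

lemma nonneg_on_if_zero_dilation:
  assumes A: "A \<in> carrier_mat n n" and z: "z \<noteq> 0"
    and dil: "has_zero_dilation (Re_mat (exp (- \<i> * of_real (Arg z)) \<cdot>\<^sub>m A)) k"
  shows "form.nonneg_on A (coord_space n) k z"
proof -
  define c where "c = exp (- \<i> * complex_of_real (Arg z))"
  have cz: "cnj z = of_real (cmod z) * c"
  proof -
    have "z = of_real (cmod z) * cis (Arg z)" using z by (metis rcis_cmod_Arg rcis_def)
    then have "cnj z = of_real (cmod z) * cnj (cis (Arg z))"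
      by (metis complex_cnj_complex_of_real complex_cnj_mult)
    also have "cnj (cis (Arg z)) = c"
      by (simp only: cis_cnj) (simp add: cis_conv_exp c_def)
    finally show ?thesis .
  qed
  obtain S where S: "S \<subseteq> coord_space n" "finite S" "cfun.independent S" "card S = k"
    "\<And>x y. x \<in> S \<Longrightarrow> y \<in> S \<Longrightarrow> mat_form (Re_mat (c \<cdot>\<^sub>m A)) x y = 0"
    using dil unfolding c_def[symmetric] has_zero_dilation_iff[OF Re_mat_carrier[OF A]]
    by (auto simp: form.isotropic_on_def)
  have "0 \<le> Re (cnj z * mat_form A y y)" if y: "y \<in> cfun.span S" for y
  proof -
    have "mat_form (Re_mat (c \<cdot>\<^sub>m A)) y y = 0"
      using form.span_orthogonal[OF S(5) y y] by simp
    then have "Re (c * mat_form A y y) = 0"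
      unfolding mat_form_Re_mat[OF A] by (simp add: complex_eq_iff)
    then have "Re (of_real (cmod z) * (c * mat_form A y y)) = 0" by (simp only: Re_mult_of_real)
    then show ?thesis by (simp only: cz mult.assoc)
  qed
  then show ?thesis unfolding form.nonneg_on_def using S by blast
qed

theorem corollary2p4:
  fixes A :: "complex mat" and n :: nat
  assumes "A \<in> carrier_mat n n"
  shows "zero_dilation_index A =
    Min {zero_dilation_index (Re_mat (exp (- \<i> * complex_of_real \<theta>) \<cdot>\<^sub>m A)) | \<theta> :: real. True}"
proof -
  define H where "H \<theta> = Re_mat (exp (- \<i> * complex_of_real \<theta>) \<cdot>\<^sub>m A)" for \<theta>
  define T where "T = {zero_dilation_index (H \<theta>) | \<theta>. True}"
  have H: "H \<theta> \<in> carrier_mat n n" for \<theta> unfolding H_def by (rule Re_mat_carrier[OF assms])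
  \<comment> \<open>The common bound \<open>n\<close> leaves finitely many values for infinitely
    many angles, so \<open>Min\<close> is attained.\<close>
  have "zero_dilation_index (H \<theta>) \<le> n" for \<theta>
    using has_zero_dilation_le[OF H] le_zero_dilation_index_iff[OF H] by blast
  then have T: "finite T" "T \<noteq> {}" by (auto simp: T_def intro: finite_subset[of _ "{..n}"])
  have "zero_dilation_index A \<le> Min T"
  proof (rule Min.boundedI[OF T])
    fix t assume "t \<in> T"
    then obtain \<theta> where t: "t = zero_dilation_index (H \<theta>)" by (auto simp: T_def)
    have "has_zero_dilation (H \<theta>) (zero_dilation_index A)"
      unfolding H_def using le_zero_dilation_index_iff[OF assms]
      by (intro has_zero_dilation_Re_mat[OF assms]) blast
    then show "zero_dilation_index A \<le> t" using le_zero_dilation_index_iff[OF H] t by simp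
  qed
  moreover have "has_zero_dilation A (Min T)"
  proof -
    obtain B where B: "finite B" "card B \<le> n" "coord_space n \<subseteq> cfun.span B"
      by (rule coord_space_spanned)
    \<comment> \<open>Genericity with respect to \<open>{1}\<close> implies
      \<open>z \<noteq> 0\<close>, so \<open>Arg z\<close> is an angle to which the bound by
      \<open>Min T\<close> applies.\<close>
    have "form.nonneg_on A (coord_space n) (Min T) z" if "generic {1} z" for z
    proof (rule nonneg_on_if_zero_dilation[OF assms])
      show "z \<noteq> 0" using that by (auto simp: generic_def)
      have "Min T \<le> zero_dilation_index (H (Arg z))" using T(1) by (intro Min_le) (auto simp: T_def)
      then have "has_zero_dilation (H (Arg z)) (Min T)" using le_zero_dilation_index_iff[OF H] by blast
      then show "has_zero_dilation (Re_mat (exp (- \<i> * of_real (Arg z)) \<cdot>\<^sub>m A)) (Min T)"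
        by (simp only: H_def)
    qed
    then show ?thesis unfolding has_zero_dilation_iff[OF assms]
      by (intro form.isotropic_on_if_nonneg_on[OF subspace_coord_space B(3,1), of "{1}"]) auto
  qed
  then have "Min T \<le> zero_dilation_index A" using le_zero_dilation_index_iff[OF assms] by blast
  ultimately show ?thesis unfolding T_def H_def by (rule antisym)
qed

end
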